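(* Let $\Omega\subset\mathbb{R}^N$ be a bounded $C^2$ domain, $p\in(1,2]$ and $f\in C(\Omega)\cap L^\infty(\Omega)$. For $\gamma>0$ let $u_\gamma\in C(\overline\Omega)$ be the unique viscosity solution of $$-\lambda_N(D^2u)+|Du|^p+\gamma u=f(x)\ \text{ in }\Omega,\qquad u=0\ \text{ on }\partial\Omega.$$ Suppose there exists a bounded subsolution $w\in\mathrm{USC}(\overline\Omega)$ of $$(\ast)\qquad -\lambda_N(D^2w)+|Dw|^p=f(x)\ \text{ in }\Omega,\qquad w=0\ \text{ on }\partial\Omega.$$ Then: a) the family $(u_\gamma)_{\gamma>0}$ is bounded in $C(\overline\Omega)$; b) there exists a sequence $\gamma_n\to0^+$ such that $u_{\gamma_n}$ converges uniformly in $\overline\Omega$ to a solution of $(\ast)$.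
   Context: For a real symmetric $N\times N$ matrix $X$, $\lambda_N(X)$ denotes its largest eigenvalue. $\mathrm{USC}$ denotes real-valued upper semicontinuous functions. For $\gamma\ge0$, an upper (lower) semicontinuous $u$ is a viscosity subsolution (supersolution) of $-\lambda_N(D^2u)+|Du|^p+\gamma u=f$ in $\Omega$ if, whenever $\varphi$ is $C^2$ and $u-\varphi$ has a local maximum (minimum) at $x\in\Omega$, one has $-\lambda_N(D^2\varphi(x))+|D\varphi(x)|^p+\gamma u(x)\le f(x)$ (respectively $\ge f(x)$). A subsolution of the Dirichlet problem with zero boundary data is a viscosity subsolution in $\Omega$ which is $\le0$ on $\partial\Omega$; a solution of the Dirichlet problem is a function in $C(\overline\Omega)$ vanishing on $\partial\Omega$ which is both a viscosity sub- and supersolution in $\Omega$. Under the stated hypotheses $u_\gamma$ exists and is unique for every $\gamma>0$. *)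

theory Defs
  imports "HOL-Analysis.Analysis"
begin

definition eigenvalue :: "real^'n^'n \<Rightarrow> real \<Rightarrow> bool" where
  "eigenvalue A l \<longleftrightarrow> (\<exists>v. v \<noteq> 0 \<and> A *v v = l *\<^sub>R v)"

text \<open>Meaningful for symmetric matrices, whose set of eigenvalues is finite and nonempty.\<close>

definition lambda_max :: "real^'n^'n \<Rightarrow> real" where
  "lambda_max A = Max {l. eigenvalue A l}"

text \<open>\<open>C2_on S \<phi> D\<phi> D2\<phi>\<close>: on the open set \<open>S\<close> the function \<open>\<phi>\<close> is twice continuously
  differentiable with gradient \<open>D\<phi>\<close> and Hessian matrix \<open>D2\<phi>\<close>. On an open set the gradient and the
  Hessian are determined by \<open>\<phi>\<close>.\<close>

definition C2_on ::
  "(real^'n) set \<Rightarrow> (real^'n \<Rightarrow> real) \<Rightarrow> (real^'n \<Rightarrow> real^'n) \<Rightarrow> (real^'n \<Rightarrow> real^'n^'n) \<Rightarrow> bool" where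
  "C2_on S \<phi> D\<phi> D2\<phi> \<longleftrightarrow>
     (\<forall>x\<in>S. (\<phi> has_derivative (\<lambda>h. D\<phi> x \<bullet> h)) (at x)) \<and>
     (\<forall>x\<in>S. (D\<phi> has_derivative (\<lambda>h. D2\<phi> x *v h)) (at x)) \<and>
     continuous_on S D2\<phi>"

definition usc_on :: "(real^'n) set \<Rightarrow> (real^'n \<Rightarrow> real) \<Rightarrow> bool" where
  "usc_on S u \<longleftrightarrow> (\<forall>x\<in>S. \<forall>c>u x. \<forall>\<^sub>F y in at x within S. u y < c)"

definition lsc_on :: "(real^'n) set \<Rightarrow> (real^'n \<Rightarrow> real) \<Rightarrow> bool" where
  "lsc_on S u \<longleftrightarrow> (\<forall>x\<in>S. \<forall>c<u x. \<forall>\<^sub>F y in at x within S. c < u y)"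

definition local_max_at :: "(real^'n) set \<Rightarrow> (real^'n \<Rightarrow> real) \<Rightarrow> real^'n \<Rightarrow> bool" where
  "local_max_at S h x \<longleftrightarrow> x \<in> S \<and> (\<exists>e>0. \<forall>y\<in>S \<inter> ball x e. h y \<le> h x)"

definition local_min_at :: "(real^'n) set \<Rightarrow> (real^'n \<Rightarrow> real) \<Rightarrow> real^'n \<Rightarrow> bool" where
  "local_min_at S h x \<longleftrightarrow> x \<in> S \<and> (\<exists>e>0. \<forall>y\<in>S \<inter> ball x e. h x \<le> h y)"

text \<open>Viscosity sub- and supersolutions of
  \<open>- \<lambda>\<^sub>N(D\<^sup>2 u) + |D u|\<^sup>p + \<gamma> u = f\<close> in the open set \<open>\<Omega>\<close>.\<close>

definition visc_subsolution ::
  "(real^'n) set \<Rightarrow> real \<Rightarrow> real \<Rightarrow> (real^'n \<Rightarrow> real) \<Rightarrow> (real^'n \<Rightarrow> real) \<Rightarrow> bool" where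
  "visc_subsolution \<Omega> p \<gamma> f u \<longleftrightarrow> usc_on \<Omega> u \<and>
     (\<forall>\<phi> D\<phi> D2\<phi> x. C2_on \<Omega> \<phi> D\<phi> D2\<phi> \<longrightarrow> local_max_at \<Omega> (\<lambda>y. u y - \<phi> y) x \<longrightarrow>
        - lambda_max (D2\<phi> x) + norm (D\<phi> x) powr p + \<gamma> * u x \<le> f x)"

definition visc_supersolution ::
  "(real^'n) set \<Rightarrow> real \<Rightarrow> real \<Rightarrow> (real^'n \<Rightarrow> real) \<Rightarrow> (real^'n \<Rightarrow> real) \<Rightarrow> bool" where
  "visc_supersolution \<Omega> p \<gamma> f u \<longleftrightarrow> lsc_on \<Omega> u \<and>
     (\<forall>\<phi> D\<phi> D2\<phi> x. C2_on \<Omega> \<phi> D\<phi> D2\<phi> \<longrightarrow> local_min_at \<Omega> (\<lambda>y. u y - \<phi> y) x \<longrightarrow>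
        - lambda_max (D2\<phi> x) + norm (D\<phi> x) powr p + \<gamma> * u x \<ge> f x)"

text \<open>Subsolutions and solutions of the Dirichlet problem with zero boundary data. Functions on the closure
  of \<open>\<Omega>\<close> are total functions whose values outside the closure are irrelevant.\<close>

definition dirichlet_subsolution ::
  "(real^'n) set \<Rightarrow> real \<Rightarrow> real \<Rightarrow> (real^'n \<Rightarrow> real) \<Rightarrow> (real^'n \<Rightarrow> real) \<Rightarrow> bool" where
  "dirichlet_subsolution \<Omega> p \<gamma> f u \<longleftrightarrow>
     visc_subsolution \<Omega> p \<gamma> f u \<and> (\<forall>x\<in>frontier \<Omega>. u x \<le> 0)"

definition dirichlet_solution ::
  "(real^'n) set \<Rightarrow> real \<Rightarrow> real \<Rightarrow> (real^'n \<Rightarrow> real) \<Rightarrow> (real^'n \<Rightarrow> real) \<Rightarrow> bool" where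
  "dirichlet_solution \<Omega> p \<gamma> f u \<longleftrightarrow>
     continuous_on (closure \<Omega>) u \<and> (\<forall>x\<in>frontier \<Omega>. u x = 0) \<and>
     visc_subsolution \<Omega> p \<gamma> f u \<and> visc_supersolution \<Omega> p \<gamma> f u"

text \<open>Near every boundary point, \<open>\<Omega>\<close> is the region strictly above the graph of a \<open>C\<^sup>2\<close> function of
  the \<open>N - 1\<close> variables orthogonal to some unit vector \<open>\<nu>\<close>. Such a function is encoded as a function
  \<open>g\<close> of all variables that is constant in the direction \<open>\<nu>\<close>.\<close>

definition C2_boundary :: "(real^'n) set \<Rightarrow> bool" where
  "C2_boundary \<Omega> \<longleftrightarrow>
     (\<forall>z\<in>frontier \<Omega>. \<exists>r>0. \<exists>\<nu> g Dg D2g.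
        norm \<nu> = 1 \<and> C2_on UNIV g Dg D2g \<and> (\<forall>x t. g (x + t *\<^sub>R \<nu>) = g x) \<and>
        \<Omega> \<inter> ball z r = {x \<in> ball z r. g x < x \<bullet> \<nu>})"

definition bounded_C2_domain :: "(real^'n) set \<Rightarrow> bool" where
  "bounded_C2_domain \<Omega> \<longleftrightarrow>
     open \<Omega> \<and> connected \<Omega> \<and> \<Omega> \<noteq> {} \<and> bounded \<Omega> \<and> C2_boundary \<Omega>"

end

theory Submission
  imports Defs "HOL-Complex_Analysis.Great_Picard"
begin

text \<open>A function \<open>u\<close> with \<open>- \<lambda>\<^sub>N(D\<^sup>2 u) + |D u|\<^sup>p + \<gamma> u \<ge> f\<close> satisfies \<open>\<lambda>\<^sub>N(D\<^sup>2 u) \<le> |D u|\<^sup>p + C\<close>, an upper bound on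
the second derivative of \<open>u\<close> in every direction. The Lipschitz estimate and the
comparison below rest on this one-sided information, which amounts to semiconcavity once \<open>D u\<close> is under control.

\<^bold>\<open>Upper bound and boundary modulus.\<close> A \<open>C\<^sup>2\<close> domain has a uniform exterior ball. If \<open>ball y R\<close> touches
\<open>\<Omega>\<close> from outside at \<open>z\<close>, the cone \<open>K (|x - y| - R)\<close> has gradient of norm \<open>K\<close> and Hessian at most
\<open>K / R\<close>; since \<open>p > 1\<close>, the term \<open>K\<^sup>p\<close> beats \<open>K / R + sup f\<close> for large \<open>K\<close>, so that the cone lies above
every subsolution with zero boundary data (\<open>subsolution_le_cone\<close>). Hence \<open>u\<^sub>\<gamma>(x) \<le> K |x - z|\<close> for all
\<open>z\<close> on the boundary, with \<open>K\<close> independent of \<open>\<gamma>\<close>.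

\<^bold>\<open>Lipschitz estimate.\<close> Since \<open>p \<le> 2\<close>, a decreasing convex profile \<open>\<phi>\<close> with \<open>\<phi>'' > (\<phi>')\<^sup>2 + C\<close> can fall by
an arbitrary amount on a short interval: \<open>\<phi>(s) = - ln (1 + k s) / 2\<close> does. A bounded supersolution
cannot be touched from below by \<open>u(x\<^sub>0) + \<phi>(|x - x\<^sub>0|)\<close> away from \<open>x\<^sub>0\<close>, and this gives a Lipschitz
bound up to the boundary that depends on the supersolution only through its bounds
(\<open>supersolution_lipschitz_bound\<close>).

\<^bold>\<open>Lower bound.\<close> If \<open>W\<close> bounds \<open>|w|\<close>, then \<open>w - W\<close> is a subsolution of the equation with any \<open>\<gamma> > 0\<close>, and
it remains to compare it with \<open>u\<^sub>\<gamma>\<close>. On a small ball a Lipschitz supersolution is semiconcave, because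
its test gradients are bounded by the Lipschitz constant (\<open>supersolution_semiconcave\<close>). Shrinking the
ball and following supergradients whose norms approach the smallest local Lipschitz constant gives, at
every point, a paraboloid that touches \<open>u\<^sub>\<gamma>\<close> from above and satisfies the supersolution inequality up to \<open>\<epsilon>\<close>
(\<open>supersolution_superjet\<close>). At a maximum of \<open>w - W - u\<^sub>\<gamma>\<close> it touches \<open>w\<close> from above as well, and testing
\<open>w\<close> with it yields \<open>w - W \<le> u\<^sub>\<gamma>\<close> (\<open>comparison_principle\<close>).

\<^bold>\<open>Limit.\<close> The bounds make \<open>(u\<^sub>\<gamma>)\<close> with \<open>\<gamma> \<le> 1\<close> equibounded and equi-Lipschitz. The Arzela-Ascoli theorem
gives a uniform limit along a sequence \<open>\<gamma>\<^sub>n \<longlonglongrightarrow> 0\<close>, and viscosity sub- and supersolutions are stable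
under uniform convergence because \<open>\<lambda>\<^sub>N\<close> is continuous on symmetric matrices.\<close>

section \<open>Symmetric matrices and their largest eigenvalue\<close>

lemma inner_symmetric_matrix:
  fixes A :: "real^'n^'n"
  assumes "transpose A = A"
  shows "(A *v x) \<bullet> y = x \<bullet> (A *v y)"
  by (metis assms dot_lmul_matrix vector_transpose_matrix)

lemma symmetric_matrixI:
  fixes A :: "real^'n^'n"
  assumes "\<And>x y. x \<bullet> (A *v y) = y \<bullet> (A *v x)"
  shows "transpose A = A"
  using assms[of "axis _ 1" "axis _ 1"]
  by (simp add: vec_eq_iff transpose_def inner_axis' matrix_vector_mul_component inner_axis)

lemma norm_matrix_vector_mult_le:
  fixes A :: "real^'n^'m"
  shows "norm (A *v x) \<le> norm A * norm x"
proof -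
  have "norm (A *v x) \<le> L2_set (\<lambda>i. norm (A $ i) * norm x) UNIV"
    unfolding norm_vec_def[of "A *v x"]
    by (rule L2_set_mono) (simp_all add: matrix_vector_mul_component Cauchy_Schwarz_ineq2)
  then show ?thesis
    by (simp add: L2_set_left_distrib norm_vec_def)
qed

lemma finite_eigenvalues:
  fixes A :: "real^'n^'n"
  assumes "transpose A = A"
  shows "finite {l. eigenvalue A l}"
proof -
  define ev where "ev l = (SOME v. v \<noteq> 0 \<and> A *v v = l *\<^sub>R v)" for l
  have ev: "ev l \<noteq> 0 \<and> A *v ev l = l *\<^sub>R ev l" if "eigenvalue A l" for l
    using someI_ex[OF that[unfolded eigenvalue_def]] unfolding ev_def .
  \<comment> \<open>Eigenvectors for different eigenvalues are orthogonal, and orthogonal families are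
    finite.\<close>
  have orth: "ev k \<bullet> ev l = 0" if "eigenvalue A k" "eigenvalue A l" "k \<noteq> l" for k l
  proof -
    have "k * (ev k \<bullet> ev l) = l * (ev k \<bullet> ev l)"
      using inner_symmetric_matrix[OF assms, of "ev k" "ev l"] ev that by simp
    then show ?thesis using \<open>k \<noteq> l\<close> by simp
  qed
  have inj: "inj_on ev {l. eigenvalue A l}"
    by (rule inj_onI) (metis ev orth inner_eq_zero_iff mem_Collect_eq)
  have "pairwise orthogonal (ev ` {l. eigenvalue A l})"
    unfolding pairwise_def orthogonal_def using orth by auto
  then have "finite (ev ` {l. eigenvalue A l})"
    by (rule pairwise_orthogonal_imp_finite)
  then show ?thesis using inj by (simp add: finite_image_iff)
qed

text \<open>First-order condition for the Rayleigh quotient: with \<open>g = A v - m v\<close>, which is orthogonal to \<open>v\<close>, the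
quotient at \<open>v + t g\<close> exceeds its maximum by a term of order \<open>t |g|\<^sup>2\<close> unless \<open>g = 0\<close>.\<close>
lemma eigenvalue_max_Rayleigh:
  fixes A :: "real^'n^'n"
  assumes sym: "transpose A = A" and v: "norm v = 1"
    and max: "\<And>x. norm x = 1 \<Longrightarrow> x \<bullet> (A *v x) \<le> v \<bullet> (A *v v)"
  shows "A *v v = (v \<bullet> (A *v v)) *\<^sub>R v"
proof -
  define m where "m = v \<bullet> (A *v v)"
  define g where "g = A *v v - m *\<^sub>R v"
  have le: "x \<bullet> (A *v x) \<le> m * (norm x)\<^sup>2" for x
  proof (cases "x = 0")
    case False
    have "(x /\<^sub>R norm x) \<bullet> (A *v (x /\<^sub>R norm x)) \<le> m"
      unfolding m_def using False by (intro max) simp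
    then show ?thesis
      using False by (simp add: matrix_vector_mult_scaleR field_simps power2_eq_square)
  qed simp
  have gv: "g \<bullet> v = 0"
    using v by (simp add: g_def m_def inner_diff_left inner_commute[of "A *v v" v] norm_eq_1)
  have gA: "g \<bullet> (A *v v) = g \<bullet> g"
    using gv by (simp add: g_def inner_diff_right inner_commute)
  \<comment> \<open>Bounds the coefficient of \<open>t\<^sup>2\<close> in the expansion along \<open>v + t g\<close>.\<close>
  define c where "c = \<bar>m * (norm g)\<^sup>2 - g \<bullet> (A *v g)\<bar>"
  have "2 * (norm g)\<^sup>2 \<le> c * t" if "t > 0" for t
  proof -
    have vg: "v \<bullet> g = 0" using gv by (simp add: inner_commute)
    have vAg: "v \<bullet> (A *v g) = g \<bullet> g"
      using gA inner_symmetric_matrix[OF sym, of v g] by (simp add: inner_commute)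
    have "(v + t *\<^sub>R g) \<bullet> (A *v (v + t *\<^sub>R g)) \<le> m * (norm (v + t *\<^sub>R g))\<^sup>2"
      by (rule le)
    then have "m + 2 * t * (g \<bullet> g) + t * t * (g \<bullet> (A *v g)) \<le> m * (1 + t * t * (g \<bullet> g))"
      unfolding dot_square_norm[symmetric]
      using vg vAg gA gv v
      by (simp add: matrix_vector_right_distrib matrix_vector_mult_scaleR inner_add_left
          inner_add_right m_def norm_eq_1 algebra_simps)
    then have "t * (2 * (g \<bullet> g)) \<le> t * (t * (m * (g \<bullet> g) - g \<bullet> (A *v g)))"
      by (simp add: algebra_simps)
    then have "2 * (g \<bullet> g) \<le> t * (m * (g \<bullet> g) - g \<bullet> (A *v g))"
      using that by simp
    also have "\<dots> \<le> t * c"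
      using that by (intro mult_left_mono) (auto simp: c_def dot_square_norm)
    finally show ?thesis by (simp add: dot_square_norm mult.commute)
  qed
  note bound = this
  have "2 * (norm g)\<^sup>2 \<le> 0"
  proof (rule field_le_epsilon)
    fix e :: real assume "e > 0"
    have "c \<ge> 0" by (simp add: c_def)
    have "2 * (norm g)\<^sup>2 \<le> c * (e / (c + 1))"
      using \<open>e > 0\<close> \<open>c \<ge> 0\<close> by (intro bound) simp
    also have "\<dots> \<le> e" using \<open>e > 0\<close> \<open>c \<ge> 0\<close> by (simp add: field_simps)
    finally show "2 * (norm g)\<^sup>2 \<le> 0 + e" by simp
  qed
  then have "g = 0" by simp
  then show ?thesis by (simp add: g_def m_def)
qed

text \<open>The variational description of \<open>\<lambda>\<^sub>N\<close>. All later estimates on \<open>lambda_max\<close> go through it.\<close>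
lemma lambda_max_attained:
  fixes A :: "real^'n^'n"
  assumes sym: "transpose A = A"
  obtains v where "norm v = 1" "v \<bullet> (A *v v) = lambda_max A"
    and "\<And>x. norm x = 1 \<Longrightarrow> x \<bullet> (A *v x) \<le> lambda_max A"
proof -
  have "continuous_on (sphere 0 1) (\<lambda>x. x \<bullet> (A *v x))"
    by (intro continuous_intros linear_continuous_on matrix_vector_mul_bounded_linear)
  moreover have "sphere (0::real^'n) 1 \<noteq> {}" by simp
  ultimately obtain v where v: "v \<in> sphere 0 1"
      and max: "\<And>x. x \<in> sphere 0 1 \<Longrightarrow> x \<bullet> (A *v x) \<le> v \<bullet> (A *v v)"
    using continuous_attains_sup[OF compact_sphere] by blast
  define m where "m = v \<bullet> (A *v v)"
  have "A *v v = m *\<^sub>R v"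
    unfolding m_def using v max by (intro eigenvalue_max_Rayleigh[OF sym]) auto
  moreover have "v \<noteq> 0" using v by auto
  ultimately have ev: "eigenvalue A m" unfolding eigenvalue_def by blast
  have le: "l \<le> m" if l: "eigenvalue A l" for l
  proof -
    obtain x where x: "x \<noteq> 0" "A *v x = l *\<^sub>R x" using l by (auto simp: eigenvalue_def)
    have "(x /\<^sub>R norm x) \<bullet> (A *v (x /\<^sub>R norm x)) \<le> m"
      unfolding m_def using x by (intro max) simp
    then show ?thesis
      using x by (simp add: matrix_vector_mult_scaleR field_simps dot_square_norm power2_eq_square)
  qed
  have "lambda_max A = m"
    unfolding lambda_max_def using finite_eigenvalues[OF sym] ev le by (intro Max_eqI) auto
  then show ?thesis using that[of v] v max by (auto simp: m_def)
qed

lemma lambda_max_ge_Rayleigh: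
  fixes A :: "real^'n^'n"
  assumes "transpose A = A" "norm e = 1"
  shows "e \<bullet> (A *v e) \<le> lambda_max A"
  using lambda_max_attained[OF assms(1)] assms(2) by metis

lemma lambda_max_le_of_Rayleigh:
  fixes A :: "real^'n^'n"
  assumes "transpose A = A" "\<And>v. norm v = 1 \<Longrightarrow> v \<bullet> (A *v v) \<le> c"
  shows "lambda_max A \<le> c"
  using lambda_max_attained[OF assms(1)] assms(2) by metis

lemma lambda_max_diff_le:
  fixes A B :: "real^'n^'n"
  assumes "transpose A = A" "transpose B = B"
  shows "lambda_max A \<le> lambda_max B + norm (A - B)"
proof (rule lambda_max_le_of_Rayleigh[OF assms(1)])
  fix v :: "real^'n" assume v: "norm v = 1"
  have "v \<bullet> (A *v v) = v \<bullet> (B *v v) + v \<bullet> ((A - B) *v v)"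
    by (simp add: matrix_vector_mult_diff_rdistrib inner_diff_right)
  moreover have "v \<bullet> ((A - B) *v v) \<le> norm (A - B)"
    using norm_cauchy_schwarz[of v "(A - B) *v v"] norm_matrix_vector_mult_le[of "A - B" v] v by simp
  ultimately show "v \<bullet> (A *v v) \<le> lambda_max B + norm (A - B)"
    using lambda_max_ge_Rayleigh[OF assms(2) v] by linarith
qed

lemma tendsto_lambda_max:
  fixes A :: "real^'n^'n"
  assumes "transpose A = A" "\<And>i. transpose (B i) = B i" "(B \<longlongrightarrow> A) F"
  shows "((\<lambda>i. lambda_max (B i)) \<longlongrightarrow> lambda_max A) F"
proof (rule Lim_null_comparison[THEN LIM_zero_cancel])
  show "((\<lambda>i. norm (B i - A)) \<longlongrightarrow> 0) F"
    using assms(3) by (simp add: LIM_zero tendsto_norm_zero)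
  show "\<forall>\<^sub>F i in F. norm (lambda_max (B i) - lambda_max A) \<le> norm (B i - A)"
    using lambda_max_diff_le[OF assms(2,1)] lambda_max_diff_le[OF assms(1,2)]
    by (intro always_eventually) (auto simp: abs_le_iff algebra_simps norm_minus_commute)
qed

lemma scaled_identity_mult: "(c *\<^sub>R mat 1 :: real^'n^'n) *v x = c *\<^sub>R x"
  by (simp add: scaleR_matrix_vector_assoc[symmetric])

lemma transpose_scaled_identity: "transpose (c *\<^sub>R mat 1 :: real^'n^'n) = c *\<^sub>R mat 1"
  by (rule symmetric_matrixI) (simp add: scaled_identity_mult inner_commute)

lemma lambda_max_add_scaled_identity:
  fixes A :: "real^'n^'n"
  assumes A: "transpose A = A"
  shows "lambda_max (A + c *\<^sub>R mat 1) = lambda_max A + c"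
proof -
  have sym: "transpose (A + c *\<^sub>R mat 1) = A + c *\<^sub>R mat 1"
  proof (rule symmetric_matrixI)
    fix x y
    have "x \<bullet> (A *v y) = y \<bullet> (A *v x)"
      using inner_symmetric_matrix[OF A, of x y] inner_commute[of "A *v x" y] by simp
    then show "x \<bullet> ((A + c *\<^sub>R mat 1) *v y) = y \<bullet> ((A + c *\<^sub>R mat 1) *v x)"
      by (simp add: matrix_vector_mult_add_rdistrib scaled_identity_mult inner_add_right inner_commute[of x y])
  qed
  have Rayleigh: "v \<bullet> ((A + c *\<^sub>R mat 1) *v v) = v \<bullet> (A *v v) + c" if "norm v = 1" for v
    using that by (simp add: matrix_vector_mult_add_rdistrib scaled_identity_mult inner_add_right norm_eq_1)
  show ?thesis
  proof (rule antisym)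
    show "lambda_max (A + c *\<^sub>R mat 1) \<le> lambda_max A + c"
      by (rule lambda_max_le_of_Rayleigh[OF sym]) (simp add: Rayleigh lambda_max_ge_Rayleigh[OF A])
    have "lambda_max A \<le> lambda_max (A + c *\<^sub>R mat 1) - c"
      by (rule lambda_max_le_of_Rayleigh[OF A])
        (use lambda_max_ge_Rayleigh[OF sym] Rayleigh in \<open>force simp: le_diff_eq\<close>)
    then show "lambda_max A + c \<le> lambda_max (A + c *\<^sub>R mat 1)" by simp
  qed
qed

section \<open>Twice continuously differentiable functions\<close>

lemma C2_onD:
  assumes "C2_on S \<phi> D\<phi> D2\<phi>"
  shows "x \<in> S \<Longrightarrow> (\<phi> has_derivative (\<lambda>h. D\<phi> x \<bullet> h)) (at x)"
    and "x \<in> S \<Longrightarrow> (D\<phi> has_derivative (\<lambda>h. D2\<phi> x *v h)) (at x)"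
    and "continuous_on S D2\<phi>"
  using assms unfolding C2_on_def by auto

lemma C2_on_subset:
  "C2_on S \<phi> D\<phi> D2\<phi> \<Longrightarrow> T \<subseteq> S \<Longrightarrow> C2_on T \<phi> D\<phi> D2\<phi>"
  unfolding C2_on_def by (meson continuous_on_subset subsetD)

lemma C2_on_imp_continuous_on:
  "C2_on S \<phi> D\<phi> D2\<phi> \<Longrightarrow> continuous_on S \<phi>"
  by (rule continuous_at_imp_continuous_on) (blast intro: has_derivative_continuous C2_onD(1))

text \<open>The mixed second difference is symmetric in \<open>h\<close> and \<open>k\<close>, while two applications of the mean value
theorem express it through \<open>D\<^sup>2\<phi>\<close> with \<open>h\<close> and \<open>k\<close> in different roles. This is the source of the symmetry
of the Hessian.\<close>
lemma second_difference_mvt: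
  fixes \<phi> :: "real^'n \<Rightarrow> real"
  assumes C2: "C2_on (ball x r) \<phi> D\<phi> D2\<phi>"
    and t: "t > 0" and tr: "t * (norm h + norm k) < r"
  obtains \<xi> where "norm (\<xi> - x) \<le> t * (norm h + norm k)"
    and "\<phi> (x + t *\<^sub>R h + t *\<^sub>R k) - \<phi> (x + t *\<^sub>R h) - \<phi> (x + t *\<^sub>R k) + \<phi> x
      = t\<^sup>2 * (h \<bullet> (D2\<phi> \<xi> *v k))"
proof -
  have inB: "norm (s *\<^sub>R h + s' *\<^sub>R k) \<le> t * (norm h + norm k)"
    if "0 \<le> s" "s \<le> t" "0 \<le> s'" "s' \<le> t" for s s'
  proof -
    have "norm (s *\<^sub>R h + s' *\<^sub>R k) \<le> s * norm h + s' * norm k"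
      using norm_triangle_ineq[of "s *\<^sub>R h" "s' *\<^sub>R k"] that by simp
    also have "\<dots> \<le> t * norm h + t * norm k"
      using that by (intro add_mono mult_right_mono) auto
    finally show ?thesis by (simp add: algebra_simps)
  qed
  have inball: "x + s *\<^sub>R h + s' *\<^sub>R k \<in> ball x r"
    if "0 \<le> s" "s \<le> t" "0 \<le> s'" "s' \<le> t" for s s'
  proof -
    have "x - (x + s *\<^sub>R h + s' *\<^sub>R k) = - (s *\<^sub>R h + s' *\<^sub>R k)" by simp
    then have "dist x (x + s *\<^sub>R h + s' *\<^sub>R k) = norm (s *\<^sub>R h + s' *\<^sub>R k)"
      unfolding dist_norm by (metis norm_minus_cancel)
    then show ?thesis using inB[OF that] tr by simp
  qed
  have d1: "(\<phi> has_derivative (\<lambda>h. D\<phi> y \<bullet> h)) (at y)" if "y \<in> ball x r" for y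
    using C2 that unfolding C2_on_def by blast
  have d2: "(D\<phi> has_derivative (\<lambda>h. D2\<phi> y *v h)) (at y)" if "y \<in> ball x r" for y
    using C2 that unfolding C2_on_def by blast
  define G where "G s = \<phi> (x + s *\<^sub>R h + t *\<^sub>R k) - \<phi> (x + s *\<^sub>R h + 0 *\<^sub>R k)" for s
  have "\<exists>z. 0 < z \<and> z < t \<and> G t - G 0 = (t - 0) *
      (D\<phi> (x + z *\<^sub>R h + t *\<^sub>R k) \<bullet> h - D\<phi> (x + z *\<^sub>R h + 0 *\<^sub>R k) \<bullet> h)"
  proof (rule MVT2[OF t])
    fix s assume s: "0 \<le> s" "s \<le> t"
    have *: "((\<lambda>s. \<phi> (x + s *\<^sub>R h + s' *\<^sub>R k)) has_derivative
        (\<lambda>a. D\<phi> (x + s *\<^sub>R h + s' *\<^sub>R k) \<bullet> (a *\<^sub>R h))) (at s)" if "0 \<le> s'" "s' \<le> t" for s'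
      by (rule has_derivative_compose[where f = "\<lambda>s. x + s *\<^sub>R h + s' *\<^sub>R k"
            and g = \<phi> and f' = "\<lambda>a. a *\<^sub>R h", OF _ d1[OF inball[OF s that]]])
        (auto intro!: derivative_eq_intros)
    show "DERIV G s :> D\<phi> (x + s *\<^sub>R h + t *\<^sub>R k) \<bullet> h - D\<phi> (x + s *\<^sub>R h + 0 *\<^sub>R k) \<bullet> h"
      unfolding G_def has_field_derivative_def
      by (rule has_derivative_eq_rhs[OF has_derivative_diff[OF *[of t] *[of 0]]])
        (use t in \<open>auto simp: algebra_simps\<close>)
  qed
  then obtain z where z: "0 < z" "z < t" and Gz: "G t - G 0 = t *
      (D\<phi> (x + z *\<^sub>R h + t *\<^sub>R k) \<bullet> h - D\<phi> (x + z *\<^sub>R h + 0 *\<^sub>R k) \<bullet> h)"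
    by auto
  define g where "g s = D\<phi> (x + z *\<^sub>R h + s *\<^sub>R k) \<bullet> h" for s
  have "\<exists>z'. 0 < z' \<and> z' < t \<and> g t - g 0 = (t - 0) *
      (h \<bullet> (D2\<phi> (x + z *\<^sub>R h + z' *\<^sub>R k) *v k))"
  proof (rule MVT2[OF t])
    fix s assume s: "0 \<le> s" "s \<le> t"
    have "((\<lambda>s. D\<phi> (x + z *\<^sub>R h + s *\<^sub>R k)) has_derivative
        (\<lambda>a. D2\<phi> (x + z *\<^sub>R h + s *\<^sub>R k) *v (a *\<^sub>R k))) (at s)"
      by (rule has_derivative_compose[where f = "\<lambda>s. x + z *\<^sub>R h + s *\<^sub>R k"
            and g = D\<phi> and f' = "\<lambda>a. a *\<^sub>R k", OF _ d2[OF inball[OF _ _ s]]])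
        (use z in \<open>auto intro!: derivative_eq_intros\<close>)
    then have "((\<lambda>s. D\<phi> (x + z *\<^sub>R h + s *\<^sub>R k) \<bullet> h) has_derivative
        (\<lambda>a. (D2\<phi> (x + z *\<^sub>R h + s *\<^sub>R k) *v (a *\<^sub>R k)) \<bullet> h)) (at s)"
      by (rule has_derivative_inner_left)
    then show "DERIV g s :> h \<bullet> (D2\<phi> (x + z *\<^sub>R h + s *\<^sub>R k) *v k)"
      unfolding g_def has_field_derivative_def
      by (rule has_derivative_eq_rhs) (auto simp: matrix_vector_mult_scaleR inner_commute)
  qed
  then obtain z' where z': "0 < z'" "z' < t" and gz: "g t - g 0 = t *
      (h \<bullet> (D2\<phi> (x + z *\<^sub>R h + z' *\<^sub>R k) *v k))"
    by auto
  show ?thesis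
  proof (rule that[of "x + z *\<^sub>R h + z' *\<^sub>R k"])
    show "norm (x + z *\<^sub>R h + z' *\<^sub>R k - x) \<le> t * (norm h + norm k)"
      using inB[of z z'] z z' by (simp add: algebra_simps)
    show "\<phi> (x + t *\<^sub>R h + t *\<^sub>R k) - \<phi> (x + t *\<^sub>R h) - \<phi> (x + t *\<^sub>R k) + \<phi> x
      = t\<^sup>2 * (h \<bullet> (D2\<phi> (x + z *\<^sub>R h + z' *\<^sub>R k) *v k))"
      using Gz gz unfolding G_def g_def by (simp add: power2_eq_square algebra_simps)
  qed
qed

lemma C2_second_difference_limit:
  fixes \<phi> :: "real^'n \<Rightarrow> real"
  assumes C2: "C2_on S \<phi> D\<phi> D2\<phi>" and S: "open S" "x \<in> S"
  shows "((\<lambda>t. (\<phi> (x + t *\<^sub>R h + t *\<^sub>R k) - \<phi> (x + t *\<^sub>R h) - \<phi> (x + t *\<^sub>R k) + \<phi> x) / t\<^sup>2)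
    \<longlongrightarrow> h \<bullet> (D2\<phi> x *v k)) (at_right 0)"
proof (rule tendstoI)
  fix e :: real assume e: "e > 0"
  obtain r where r: "r > 0" "ball x r \<subseteq> S" using S by (meson openE)
  have "isCont D2\<phi> x" using C2 S unfolding C2_on_def by (simp add: continuous_on_eq_continuous_at)
  then have "isCont (\<lambda>y. h \<bullet> (D2\<phi> y *v k)) x"
    unfolding matrix_vector_mult_def isCont_def by (intro tendsto_intros)
  then obtain d where d: "d > 0"
      and dd: "\<And>y. dist y x < d \<Longrightarrow> dist (h \<bullet> (D2\<phi> y *v k)) (h \<bullet> (D2\<phi> x *v k)) < e"
    unfolding continuous_at_eps_delta using e by blast
  define b where "b = min r d / (norm h + norm k + 1)"
  have b: "b > 0" using r d by (simp add: b_def add_nonneg_pos)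
  show "\<forall>\<^sub>F t in at_right 0. dist ((\<phi> (x + t *\<^sub>R h + t *\<^sub>R k) - \<phi> (x + t *\<^sub>R h) - \<phi> (x + t *\<^sub>R k) + \<phi> x) / t\<^sup>2)
      (h \<bullet> (D2\<phi> x *v k)) < e"
    using eventually_at_right_real[OF b]
  proof eventually_elim
    case (elim t)
    then have t: "t > 0" "t < b" by auto
    have "t * (norm h + norm k) \<le> t * (norm h + norm k + 1)" using t by simp
    also have "\<dots> < b * (norm h + norm k + 1)" using t by (intro mult_strict_right_mono) (simp_all add: add_nonneg_pos)
    also have "\<dots> = min r d"
      using add_nonneg_pos[of "norm h + norm k" 1] by (simp add: b_def)
    finally have tb: "t * (norm h + norm k) < min r d" .
    obtain \<xi> where "norm (\<xi> - x) \<le> t * (norm h + norm k)"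
      "\<phi> (x + t *\<^sub>R h + t *\<^sub>R k) - \<phi> (x + t *\<^sub>R h) - \<phi> (x + t *\<^sub>R k) + \<phi> x
      = t\<^sup>2 * (h \<bullet> (D2\<phi> \<xi> *v k))"
      using second_difference_mvt[OF C2_on_subset[OF C2 r(2)] t(1), of h k] tb by auto
    then show ?case using dd[of \<xi>] tb t by (simp add: dist_norm)
  qed
qed

text \<open>Schwarz's theorem. Symmetry must be derived, since \<open>lambda_max\<close> behaves well only on symmetric matrices.\<close>
lemma C2_Hessian_symmetric:
  fixes \<phi> :: "real^'n \<Rightarrow> real"
  assumes "C2_on S \<phi> D\<phi> D2\<phi>" and "open S" "x \<in> S"
  shows "transpose (D2\<phi> x) = D2\<phi> x"
proof -
  have "h \<bullet> (D2\<phi> x *v k) = k \<bullet> (D2\<phi> x *v h)" for h k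
  proof (rule tendsto_unique)
    show "((\<lambda>t. (\<phi> (x + t *\<^sub>R h + t *\<^sub>R k) - \<phi> (x + t *\<^sub>R h) - \<phi> (x + t *\<^sub>R k) + \<phi> x) / t\<^sup>2)
        \<longlongrightarrow> h \<bullet> (D2\<phi> x *v k)) (at_right 0)"
      by (rule C2_second_difference_limit[OF assms])
    show "((\<lambda>t. (\<phi> (x + t *\<^sub>R h + t *\<^sub>R k) - \<phi> (x + t *\<^sub>R h) - \<phi> (x + t *\<^sub>R k) + \<phi> x) / t\<^sup>2)
        \<longlongrightarrow> k \<bullet> (D2\<phi> x *v h)) (at_right 0)"
      using C2_second_difference_limit[OF assms, of k h]
      by (rule Lim_transform_eventually) (simp add: algebra_simps)
  qed simp
  then show ?thesis by (rule symmetric_matrixI)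
qed

lemma C2_on_quadratic:
  fixes A :: "real^'n^'n"
  assumes "transpose A = A"
  shows "C2_on S (\<lambda>x. q \<bullet> (x - z) + (x - z) \<bullet> (A *v (x - z)) / 2) (\<lambda>x. q + A *v (x - z)) (\<lambda>x. A)"
  unfolding C2_on_def
proof (intro conjI ballI)
  fix x
  have A: "((\<lambda>x. A *v (x - z)) has_derivative (\<lambda>h. A *v h)) (at x)" for x
    by (rule has_derivative_eq_rhs[OF bounded_linear.has_derivative[OF matrix_vector_mul_bounded_linear]])
      (auto intro!: derivative_eq_intros)
  show "((\<lambda>x. q + A *v (x - z)) has_derivative (\<lambda>h. A *v h)) (at x)"
    using has_derivative_add[OF has_derivative_const A] by simp
  have sym: "h \<bullet> (A *v (x - z)) = (x - z) \<bullet> (A *v h)" for h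
    by (subst inner_symmetric_matrix[OF assms, symmetric]) (rule inner_commute)
  show "((\<lambda>x. q \<bullet> (x - z) + (x - z) \<bullet> (A *v (x - z)) / 2) has_derivative
      (\<lambda>h. (q + A *v (x - z)) \<bullet> h)) (at x)"
  proof (rule has_derivative_eq_rhs)
    show "((\<lambda>x. q \<bullet> (x - z) + (x - z) \<bullet> (A *v (x - z)) / 2) has_derivative
        (\<lambda>h. q \<bullet> h + ((x - z) \<bullet> (A *v h) + h \<bullet> (A *v (x - z))) / 2)) (at x)"
      by (auto intro!: derivative_eq_intros A)
    show "(\<lambda>h. q \<bullet> h + ((x - z) \<bullet> (A *v h) + h \<bullet> (A *v (x - z))) / 2)
        = (\<lambda>h. (q + A *v (x - z)) \<bullet> h)"
      unfolding inner_add_left inner_symmetric_matrix[OF assms] using sym by auto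
  qed
qed simp

lemma C2_on_add_paraboloid:
  fixes \<phi> :: "real^'n \<Rightarrow> real"
  assumes C2: "C2_on S \<phi> D\<phi> D2\<phi>"
  shows "C2_on S (\<lambda>y. \<phi> y + c / 2 * (norm (y - z))\<^sup>2) (\<lambda>y. D\<phi> y + c *\<^sub>R (y - z)) (\<lambda>y. D2\<phi> y + c *\<^sub>R mat 1)"
proof -
  have Q: "C2_on S (\<lambda>y. c / 2 * (norm (y - z))\<^sup>2) (\<lambda>y. c *\<^sub>R (y - z)) (\<lambda>y. c *\<^sub>R mat 1)"
    using C2_on_quadratic[OF transpose_scaled_identity, of S 0 z c]
    by (simp add: scaled_identity_mult dot_square_norm)
  show ?thesis
    unfolding C2_on_def
  proof (intro conjI ballI)
    fix x assume x: "x \<in> S"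
    have "((\<lambda>y. \<phi> y + c / 2 * (norm (y - z))\<^sup>2) has_derivative (\<lambda>h. D\<phi> x \<bullet> h + c *\<^sub>R (x - z) \<bullet> h)) (at x)"
      by (rule has_derivative_add[OF C2_onD(1)[OF C2 x] C2_onD(1)[OF Q x]])
    then show "((\<lambda>y. \<phi> y + c / 2 * (norm (y - z))\<^sup>2) has_derivative (\<lambda>h. (D\<phi> x + c *\<^sub>R (x - z)) \<bullet> h)) (at x)"
      unfolding inner_add_left .
    have "((\<lambda>y. D\<phi> y + c *\<^sub>R (y - z)) has_derivative (\<lambda>h. D2\<phi> x *v h + (c *\<^sub>R mat 1) *v h)) (at x)"
      by (rule has_derivative_add[OF C2_onD(2)[OF C2 x] C2_onD(2)[OF Q x]])
    then show "((\<lambda>y. D\<phi> y + c *\<^sub>R (y - z)) has_derivative (\<lambda>h. (D2\<phi> x + c *\<^sub>R mat 1) *v h)) (at x)"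
      unfolding matrix_vector_mult_add_rdistrib .
  next
    show "continuous_on S (\<lambda>y. D2\<phi> y + c *\<^sub>R mat 1)"
      by (intro continuous_intros C2_onD(3)[OF C2])
  qed
qed

lemma C2_lower_quadratic_bound:
  fixes g :: "real^'n \<Rightarrow> real"
  assumes C2: "C2_on UNIV g Dg D2g"
  obtains M where "M > 0"
    and "\<And>x z. x \<in> cball z0 r \<Longrightarrow> z \<in> cball z0 r \<Longrightarrow> g z + Dg z \<bullet> (x - z) - M * (norm (x - z))\<^sup>2 \<le> g x"
proof -
  have d1: "(g has_derivative (\<lambda>h. Dg x \<bullet> h)) (at x)" for x by (rule C2_onD(1)[OF C2]) simp
  have d2: "(Dg has_derivative (\<lambda>h. D2g x *v h)) (at x)" for x
    by (rule C2_onD(2)[OF C2]) simp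
  have "continuous_on (cball z0 r) D2g" using C2 continuous_on_subset unfolding C2_on_def by blast
  then have "bounded (D2g ` cball z0 r)"
    by (intro compact_imp_bounded compact_continuous_image) auto
  then obtain M where M: "M > 0" "\<And>x. x \<in> cball z0 r \<Longrightarrow> norm (D2g x) \<le> M"
    unfolding bounded_pos by blast
  have Dg: "norm (Dg x - Dg z) \<le> M * norm (x - z)" if "x \<in> cball z0 r" "z \<in> cball z0 r" for x z
  proof (rule differentiable_bound[OF convex_cball _ _ that])
    show "(Dg has_derivative (\<lambda>h. D2g x *v h)) (at x within cball z0 r)" for x
      using d2 by (rule has_derivative_at_withinI)
    show "onorm (\<lambda>h. D2g x *v h) \<le> M" if "x \<in> cball z0 r" for x
      using M(2)[OF that] norm_matrix_vector_mult_le[of "D2g x"]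
      by (intro onorm_le) (meson mult_right_mono norm_ge_zero order_trans)
  qed
  show ?thesis
  proof (rule that[OF M(1)])
    fix x z assume xz: "x \<in> cball z0 r" "z \<in> cball z0 r"
    have seg: "closed_segment x z \<subseteq> cball z0 r" using xz by (simp add: closed_segment_subset)
    have "norm ((g x - Dg z \<bullet> x) - (g z - Dg z \<bullet> z)) \<le> M * norm (x - z) * norm (x - z)"
    proof (rule differentiable_bound[where f = "\<lambda>x. g x - Dg z \<bullet> x" and S = "closed_segment x z"
          and f' = "\<lambda>y h. Dg y \<bullet> h - Dg z \<bullet> h"])
      show "((\<lambda>x. g x - Dg z \<bullet> x) has_derivative (\<lambda>h. Dg y \<bullet> h - Dg z \<bullet> h)) (at y within closed_segment x z)" for y
        by (rule has_derivative_at_withinI) (auto intro!: derivative_eq_intros d1)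
      show "onorm (\<lambda>h. Dg y \<bullet> h - Dg z \<bullet> h) \<le> M * norm (x - z)" if y: "y \<in> closed_segment x z" for y
      proof (rule onorm_le)
        fix h
        have "norm (Dg y - Dg z) \<le> M * norm (y - z)" using Dg y seg xz by blast
        also have "\<dots> \<le> M * norm (x - z)"
          using M(1) segment_bound(2)[OF y] by (simp add: norm_minus_commute)
        finally have "norm (Dg y - Dg z) \<le> M * norm (x - z)" .
        moreover have "norm (Dg y \<bullet> h - Dg z \<bullet> h) \<le> norm (Dg y - Dg z) * norm h"
          using Cauchy_Schwarz_ineq2[of "Dg y - Dg z" h] by (simp add: inner_diff_left)
        ultimately show "norm (Dg y \<bullet> h - Dg z \<bullet> h) \<le> M * norm (x - z) * norm h"
          by (meson mult_right_mono norm_ge_zero order_trans)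
      qed
    qed auto
    then show "g z + Dg z \<bullet> (x - z) - M * (norm (x - z))\<^sup>2 \<le> g x"
      by (simp add: inner_diff_right power2_eq_square abs_le_iff algebra_simps)
  qed
qed

section \<open>Quadratic test functions\<close>

lemma supersolution_quadratic_test:
  fixes A :: "real^'n^'n"
  assumes super: "visc_supersolution \<Omega> p \<gamma> f u" and x: "x \<in> \<Omega>" and A: "transpose A = A"
    and d: "d > 0"
    and test: "\<And>h. norm h < d \<Longrightarrow> x + h \<in> \<Omega> \<Longrightarrow> u x + q \<bullet> h + h \<bullet> (A *v h) / 2 \<le> u (x + h)"
  shows "lambda_max A \<le> norm q powr p + \<gamma> * u x - f x"
proof -
  have "local_min_at \<Omega> (\<lambda>y. u y - (q \<bullet> (y - x) + (y - x) \<bullet> (A *v (y - x)) / 2)) x"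
    unfolding local_min_at_def
  proof (intro conjI exI ballI)
    fix y assume y: "y \<in> \<Omega> \<inter> ball x d"
    then show "u x - (q \<bullet> (x - x) + (x - x) \<bullet> (A *v (x - x)) / 2)
        \<le> u y - (q \<bullet> (y - x) + (y - x) \<bullet> (A *v (y - x)) / 2)"
      using test[of "y - x"] by (simp add: dist_norm norm_minus_commute)
  qed (use x d in auto)
  with super C2_on_quadratic[OF A, of \<Omega> q x]
  have "f x \<le> - lambda_max A + norm (q + A *v (x - x)) powr p + \<gamma> * u x"
    unfolding visc_supersolution_def by blast
  then show ?thesis by simp
qed

lemma subsolution_quadratic_test:
  fixes A :: "real^'n^'n"
  assumes sub: "visc_subsolution \<Omega> p \<gamma> f u" and x: "x \<in> \<Omega>" and A: "transpose A = A"
    and d: "d > 0"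
    and test: "\<And>h. norm h < d \<Longrightarrow> x + h \<in> \<Omega> \<Longrightarrow> u (x + h) \<le> u x + q \<bullet> h + h \<bullet> (A *v h) / 2"
  shows "norm q powr p + \<gamma> * u x - f x \<le> lambda_max A"
proof -
  have "local_max_at \<Omega> (\<lambda>y. u y - (q \<bullet> (y - x) + (y - x) \<bullet> (A *v (y - x)) / 2)) x"
    unfolding local_max_at_def
  proof (intro conjI exI ballI)
    fix y assume y: "y \<in> \<Omega> \<inter> ball x d"
    then show "u y - (q \<bullet> (y - x) + (y - x) \<bullet> (A *v (y - x)) / 2)
        \<le> u x - (q \<bullet> (x - x) + (x - x) \<bullet> (A *v (x - x)) / 2)"
      using test[of "y - x"] by (simp add: dist_norm norm_minus_commute)
  qed (use x d in auto)
  with sub C2_on_quadratic[OF A, of \<Omega> q x]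
  have "- lambda_max A + norm (q + A *v (x - x)) powr p + \<gamma> * u x \<le> f x"
    unfolding visc_subsolution_def by blast
  then show ?thesis by simp
qed

text \<open>The only form in which supersolutions are tested by an explicit function: second derivative \<open>b\<close> in one
direction \<open>e\<close> and second derivative \<open>- 2 k\<close>, however negative, orthogonally to it. As \<open>\<lambda>\<^sub>N\<close> is the
largest eigenvalue, it is at least the Rayleigh quotient \<open>b\<close> of \<open>e\<close>.\<close>
lemma supersolution_directional_test:
  fixes e :: "real^'n"
  assumes super: "visc_supersolution \<Omega> p \<gamma> f u" and x: "x \<in> \<Omega>" and e: "norm e = 1"
    and d: "d > 0"
    and test: "\<And>h. norm h < d \<Longrightarrow> x + h \<in> \<Omega> \<Longrightarrow>
      u x + q \<bullet> h + b / 2 * (e \<bullet> h)\<^sup>2 - k * ((norm h)\<^sup>2 - (e \<bullet> h)\<^sup>2) \<le> u (x + h)"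
  shows "b \<le> norm q powr p + \<gamma> * u x - f x"
proof -
  define A where "A = matrix (\<lambda>h. ((b + 2 * k) * (e \<bullet> h)) *\<^sub>R e - (2 * k) *\<^sub>R h)"
  have Av: "A *v h = ((b + 2 * k) * (e \<bullet> h)) *\<^sub>R e - (2 * k) *\<^sub>R h" for h
    unfolding A_def
    by (subst matrix_vector_mul) (auto intro!: linearI simp: inner_add_right algebra_simps)
  have A: "transpose A = A"
    by (rule symmetric_matrixI) (simp add: Av inner_diff_right inner_commute)
  have "b = e \<bullet> (A *v e)"
    using e by (simp add: Av inner_diff_right norm_eq_1)
  also have "\<dots> \<le> lambda_max A" by (rule lambda_max_ge_Rayleigh[OF A e])
  also have "\<dots> \<le> norm q powr p + \<gamma> * u x - f x"
  proof (rule supersolution_quadratic_test[OF super x A d])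
    fix h assume "norm h < d" "x + h \<in> \<Omega>"
    then show "u x + q \<bullet> h + h \<bullet> (A *v h) / 2 \<le> u (x + h)"
      using test[of h]
      by (simp add: Av inner_diff_right dot_square_norm inner_commute[of h e] power2_eq_square[of "e \<bullet> h"] algebra_simps add_divide_distrib diff_divide_distrib)
  qed
  finally show ?thesis .
qed

lemma subsolution_paraboloid_test:
  fixes x :: "real^'n"
  assumes sub: "visc_subsolution \<Omega> p \<gamma> f u" and x: "x \<in> \<Omega>" and d: "d > 0"
    and test: "\<And>h. norm h < d \<Longrightarrow> x + h \<in> \<Omega> \<Longrightarrow> u (x + h) \<le> u x + q \<bullet> h + c / 2 * (norm h)\<^sup>2"
  shows "norm q powr p + \<gamma> * u x - f x \<le> c"
proof -
  define A :: "real^'n^'n" where "A = c *\<^sub>R mat 1"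
  have Av: "A *v h = c *\<^sub>R h" for h by (simp add: A_def scaled_identity_mult)
  have A: "transpose A = A" by (simp add: A_def transpose_scaled_identity)
  have "norm q powr p + \<gamma> * u x - f x \<le> lambda_max A"
  proof (rule subsolution_quadratic_test[OF sub x A d])
    fix h assume "norm h < d" "x + h \<in> \<Omega>"
    then show "u (x + h) \<le> u x + q \<bullet> h + h \<bullet> (A *v h) / 2"
      using test[of h] by (simp add: Av dot_square_norm)
  qed
  also have "\<dots> \<le> c"
    by (rule lambda_max_le_of_Rayleigh[OF A]) (simp add: Av norm_eq_1)
  finally show ?thesis .
qed

text \<open>A quadratic touching \<open>u\<close> from below cannot be steeper than \<open>u\<close>: compare the two along the direction of
the gradient \<open>q\<close>.\<close>
lemma lipschitz_test_gradient_le: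
  fixes u :: "'a::euclidean_space \<Rightarrow> real"
  assumes lip: "L-lipschitz_on (ball x d) u" and d: "d > 0" and e: "norm e = 1"
    and test: "\<And>h. norm h < d \<Longrightarrow>
      u x + q \<bullet> h + b / 2 * (e \<bullet> h)\<^sup>2 - k * ((norm h)\<^sup>2 - (e \<bullet> h)\<^sup>2) \<le> u (x + h)"
  shows "norm q \<le> L"
proof (cases "q = 0")
  case True
  then show ?thesis using lip by (simp add: lipschitz_on_def)
next
  case False
  define M where "M = \<bar>b / 2\<bar> + \<bar>k\<bar>"
  have M: "u x + q \<bullet> h - M * (norm h)\<^sup>2 \<le> u (x + h)" if "norm h < d" for h
  proof -
    have eh: "(e \<bullet> h)\<^sup>2 \<le> (norm h)\<^sup>2"
      using Cauchy_Schwarz_ineq2[of e h] e by (simp add: abs_le_square_iff[symmetric])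
    have "- (\<bar>b / 2\<bar> * (norm h)\<^sup>2) \<le> b / 2 * (e \<bullet> h)\<^sup>2"
      using mult_mono[OF order_refl eh, of "\<bar>b / 2\<bar>"] abs_ge_minus_self[of "b/2 * (e \<bullet> h)\<^sup>2"]
      by (simp add: abs_mult)
    moreover have "k * ((norm h)\<^sup>2 - (e \<bullet> h)\<^sup>2) \<le> \<bar>k\<bar> * (norm h)\<^sup>2"
      using eh by (intro mult_mono) auto
    ultimately show ?thesis using test[OF that] by (simp add: M_def algebra_simps)
  qed
  have M0: "M \<ge> 0" by (simp add: M_def)
  show ?thesis
  proof (rule field_le_epsilon)
    fix \<epsilon> :: real assume \<epsilon>: "\<epsilon> > 0"
    define t where "t = min (d / (2 * norm q)) (\<epsilon> / (M * norm q + 1))"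
    have M1: "M * norm q + 1 > 0" using M0 by (simp add: add_nonneg_pos)
    have t: "t > 0" using d False \<epsilon> M1 by (simp add: t_def)
    have tq: "norm (t *\<^sub>R q) < d"
    proof -
      have "t * norm q \<le> d / (2 * norm q) * norm q" unfolding t_def by (intro mult_right_mono) auto
      also have "\<dots> < d" using False d by simp
      finally show ?thesis using t by simp
    qed
    have "u x + t * (norm q)\<^sup>2 - M * (t * norm q)\<^sup>2 \<le> u (x + t *\<^sub>R q)"
      using M[OF tq] t by (simp add: dot_square_norm power_mult_distrib)
    also have "\<dots> \<le> u x + L * (t * norm q)"
      using lipschitz_onD[OF lip, of "x + t *\<^sub>R q" x] tq d t by (simp add: dist_norm)
    finally have "(t * norm q) * norm q \<le> (t * norm q) * (L + M * (t * norm q))"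
      by (simp add: power2_eq_square algebra_simps)
    moreover have "t * norm q > 0" using t False by simp
    ultimately have "norm q \<le> L + M * (t * norm q)" by (rule mult_left_le_imp_le)
    then have "norm q \<le> L + t * (M * norm q)" by (simp add: algebra_simps)
    also have "t * (M * norm q) \<le> \<epsilon>"
    proof -
      have "t * (M * norm q) \<le> t * (M * norm q + 1)" using t by simp
      also have "\<dots> \<le> \<epsilon> / (M * norm q + 1) * (M * norm q + 1)"
        using M1 unfolding t_def by (intro mult_right_mono) auto
      finally show ?thesis using M1 by simp
    qed
    finally show "norm q \<le> L + \<epsilon>" by simp
  qed
qed

section \<open>Semiconcavity of Lipschitz supersolutions\<close>

text \<open>\<open>\<lambda>\<^sub>N(D\<^sup>2 v) \<le> 0\<close> in the viscosity sense implies concavity. If \<open>v\<close> lies below its chord somewhere on a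
segment, it still does so after the chord is made to sag into a convex parabola with small second derivative
\<open>\<delta>\<close>. Extending this parabola by \<open>- k |dist to the line|\<^sup>2\<close> with large \<open>k\<close> to a thin tube around the
segment makes it touch \<open>v\<close> from below, up to a constant, at an interior point of the tube.\<close>
lemma concave_of_no_convex_test:
  fixes v :: "'a::euclidean_space \<Rightarrow> real"
  assumes B: "open B" "convex B" and cont: "continuous_on B v"
    and no_test: "\<And>x q e b k d. x \<in> B \<Longrightarrow> norm e = 1 \<Longrightarrow> b > 0 \<Longrightarrow> d > 0 \<Longrightarrow> ball x d \<subseteq> B \<Longrightarrow>
      (\<And>h. norm h < d \<Longrightarrow> v x + q \<bullet> h + b / 2 * (e \<bullet> h)\<^sup>2 - k * ((norm h)\<^sup>2 - (e \<bullet> h)\<^sup>2) \<le> v (x + h))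
      \<Longrightarrow> False"
  shows "concave_on B v"
proof (rule ccontr)
  assume "\<not> concave_on B v"
  then obtain a z s t where az: "a \<in> B" "z \<in> B" and st: "0 \<le> s" "0 \<le> t" "s + t = 1"
      and lt0: "v (s *\<^sub>R a + t *\<^sub>R z) < s * v a + t * v z"
    using B(2) unfolding concave_on_iff by (auto simp: not_le)
  have s: "s = 1 - t" and t: "0 \<le> t" "t \<le> 1" using st by auto
  have lt: "v ((1 - t) *\<^sub>R a + t *\<^sub>R z) < (1 - t) * v a + t * v z"
    using lt0 unfolding s .
  define l where "l = norm (z - a)"
  define e where "e = (z - a) /\<^sub>R l"
  have "a \<noteq> z" using lt by (auto simp: scaleR_diff_left left_diff_distrib)
  then have l: "l > 0" by (simp add: l_def)
  have e: "norm e = 1" using l by (simp add: e_def l_def)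
  have z: "z = a + l *\<^sub>R e" using l by (simp add: e_def)
  define m where "m = (v z - v a) / l"
  \<comment> \<open>\<open>T\<close> is the coordinate along the segment, measured from \<open>a\<close>, and \<open>P\<close> the squared
    distance to its line.\<close>
  define T where "T x = e \<bullet> (x - a)" for x
  define P where "P x = (norm (x - a))\<^sup>2 - (T x)\<^sup>2" for x
  define y where "y = (1 - t) *\<^sub>R a + t *\<^sub>R z"
  have ya: "y - a = (t * l) *\<^sub>R e" by (simp add: y_def z algebra_simps)
  have ee: "e \<bullet> e = 1" using e by (simp add: norm_eq_1)
  have Ty: "T y = t * l" by (simp add: T_def ya ee)
  have Py: "P y = 0" using t l e by (simp add: P_def Ty) (simp add: ya)
  define \<eta> where "\<eta> = v a + m * T y - v y"
  have \<eta>: "\<eta> > 0"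
  proof -
    have "m * T y = t * (v z - v a)" using l by (simp add: Ty m_def)
    then show ?thesis using lt[folded y_def] by (simp add: \<eta>_def algebra_simps)
  qed
  \<comment> \<open>Bending the chord by \<open>\<delta> / 2 * T * (l - T)\<close> costs at most \<open>\<delta> * l\<^sup>2 / 8 = \<eta> / 2\<close>, half
    of the gap \<open>\<eta>\<close>.\<close>
  define \<delta> where "\<delta> = 4 * \<eta> / l\<^sup>2"
  have \<delta>: "\<delta> > 0" using \<eta> l by (simp add: \<delta>_def)
  define G where "G x = v x - (v a + m * T x) + \<delta> / 2 * (T x * (l - T x))" for x
  have P_eq: "P x = (norm (x - (a + T x *\<^sub>R e)))\<^sup>2" for x
    unfolding P_def T_def dot_square_norm[symmetric]
    by (simp add: inner_diff_left inner_diff_right inner_add_left inner_add_right ee inner_commute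
        power2_eq_square algebra_simps)
  have Gy: "G y \<le> - \<eta> / 2"
  proof -
    have "t * (1 - t) \<le> 1 / 4"
      using zero_le_power2[of "2 * t - 1"] by (simp add: power2_eq_square algebra_simps)
    then have "\<delta> / 2 * (l\<^sup>2 * (t * (1 - t))) \<le> \<delta> / 2 * (l\<^sup>2 * (1 / 4))"
      using \<delta> by (intro mult_left_mono) auto
    also have "\<dots> = \<eta> / 2" using l by (simp add: \<delta>_def)
    finally have "\<delta> / 2 * (t * l * (l - t * l)) \<le> \<eta> / 2"
      by (simp add: power2_eq_square algebra_simps)
    moreover have "v y - (v a + m * (t * l)) = - \<eta>" by (simp add: \<eta>_def Ty)
    ultimately show ?thesis unfolding G_def Ty by linarith
  qed
  have seg: "closed_segment a z \<subseteq> B" using az B(2) by (simp add: closed_segment_subset)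
  obtain r1 where r1: "r1 > 0" "(\<Union>x\<in>closed_segment a z. cball x r1) \<subseteq> B"
    using compact_subset_open_imp_cball_epsilon_subset[OF compact_segment B(1) seg] by metis
  have near: "\<exists>r>0. \<forall>x. dist x c \<le> r \<longrightarrow> v x > v c - \<eta> / 2" if "c \<in> B" for c
  proof -
    have "isCont v c" using cont B(1) that by (simp add: continuous_on_eq_continuous_at)
    then obtain d where "d > 0" "\<And>x. dist x c < d \<Longrightarrow> dist (v x) (v c) < \<eta> / 2"
      unfolding continuous_at_eps_delta using \<eta> by (metis half_gt_zero)
    note d = this
    have "v x > v c - \<eta> / 2" if "dist x c \<le> d / 2" for x
      using d(2)[of x] that d(1) unfolding dist_real_def by linarith
    then show ?thesis using d(1) half_gt_zero by blast
  qed
  obtain r2 where r2: "r2 > 0" "\<And>x. dist x a \<le> r2 \<Longrightarrow> v x > v a - \<eta> / 2" using near[OF az(1)] by blast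
  obtain r3 where r3: "r3 > 0" "\<And>x. dist x z \<le> r3 \<Longrightarrow> v x > v z - \<eta> / 2" using near[OF az(2)] by blast
  define r where "r = min r1 (min r2 r3)"
  have r: "r > 0" using r1 r2 r3 by (simp add: r_def)
  define S where "S = {x. 0 \<le> T x \<and> T x \<le> l \<and> P x \<le> r\<^sup>2}"
  have contT: "continuous_on U T" for U unfolding T_def by (intro continuous_intros)
  have contP: "continuous_on U P" for U unfolding P_def T_def by (intro continuous_intros)
  have SB: "S \<subseteq> B"
  proof
    fix x assume x: "x \<in> S"
    have "a + T x *\<^sub>R e = (1 - T x / l) *\<^sub>R a + (T x / l) *\<^sub>R z"
      using l by (simp add: z algebra_simps)
    then have "a + T x *\<^sub>R e \<in> closed_segment a z"
      using x l unfolding S_def closed_segment_def by (auto intro!: exI[of _ "T x / l"])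
    moreover have "x \<in> cball (a + T x *\<^sub>R e) r1"
      using x r power2_le_imp_le[of "norm (x - (a + T x *\<^sub>R e))" r]
      by (simp add: S_def P_eq[symmetric] dist_norm norm_minus_commute r_def)
    ultimately show "x \<in> B" using r1 by blast
  qed
  have "compact S"
  proof (rule compact_eq_bounded_closed[THEN iffD2], rule conjI)
    show "bounded S"
    proof (rule bounded_subset[OF bounded_cball])
      show "S \<subseteq> cball a (r + l)"
      proof
        fix x assume x: "x \<in> S"
        have "norm (x - (a + T x *\<^sub>R e)) \<le> r"
          using x r power2_le_imp_le[of "norm (x - (a + T x *\<^sub>R e))" r] by (simp add: S_def P_eq[symmetric])
        moreover have "norm (T x *\<^sub>R e) \<le> l" using x e by (simp add: S_def)
        moreover have "norm (x - a) \<le> norm (x - (a + T x *\<^sub>R e)) + norm (T x *\<^sub>R e)"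
          using norm_triangle_ineq[of "x - (a + T x *\<^sub>R e)" "T x *\<^sub>R e"] by simp
        ultimately show "x \<in> cball a (r + l)" by (simp add: dist_norm norm_minus_commute)
      qed
    qed
    show "closed S"
      unfolding S_def
      by (intro closed_Collect_conj closed_Collect_le contT contP continuous_on_const)
  qed
  moreover have yS: "y \<in> S"
    using t l r by (simp add: S_def Ty Py mult_left_le_one_le)
  moreover have contG: "continuous_on S G"
    unfolding G_def by (intro continuous_intros contT continuous_on_subset[OF cont SB])
  ultimately obtain g where g: "\<And>x. x \<in> S \<Longrightarrow> G g \<le> G x"
    using continuous_attains_inf[of S G] by blast
  \<comment> \<open>With this \<open>k\<close> the penalty on the lateral boundary of the tube outweighs any negative
    value of \<open>G\<close>; at the two ends the choice of \<open>r\<close> excludes a minimum.\<close>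
  define k where "k = (\<bar>G g\<bar> + 1) / r\<^sup>2"
  have k: "k > 0" using r by (simp add: k_def)
  have "continuous_on S (\<lambda>x. G x + k * P x)"
    by (intro continuous_intros contG contP)
  then obtain x where x: "x \<in> S" and min: "\<And>x'. x' \<in> S \<Longrightarrow> G x + k * P x \<le> G x' + k * P x'"
    using continuous_attains_inf[of S "\<lambda>x. G x + k * P x"] \<open>compact S\<close> yS by blast
  have Fx: "G x + k * P x \<le> - \<eta> / 2" using min[OF yS] Gy Py by simp
  have P0: "P x \<ge> 0" by (simp add: P_eq)
  have kP: "k * P x \<ge> 0" using P0 k by simp
  have "P x \<noteq> r\<^sup>2"
  proof
    assume "P x = r\<^sup>2"
    then have "k * P x = \<bar>G g\<bar> + 1" using r by (simp add: k_def)
    then show False using g[OF x] Fx \<eta> by linarith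
  qed
  moreover have "T x \<noteq> 0"
  proof
    assume T0: "T x = 0"
    have "dist x a \<le> r2"
      using x r power2_le_imp_le[of "norm (x - a)" r] T0 by (simp add: S_def P_eq r_def dist_norm)
    then have "G x > - \<eta> / 2" using r2(2)[of x] by (simp add: G_def T0)
    then show False using Fx kP by linarith
  qed
  moreover have "T x \<noteq> l"
  proof
    assume Tl: "T x = l"
    have "dist x z \<le> r3"
      using x r power2_le_imp_le[of "norm (x - z)" r] Tl
      by (simp add: S_def P_eq r_def dist_norm z[symmetric])
    moreover have "v a + m * l = v z" using l by (simp add: m_def)
    ultimately have "G x > - \<eta> / 2" using r3(2)[of x] by (simp add: G_def Tl)
    then show False using Fx kP by linarith
  qed
  ultimately have "x \<in> {x. 0 < T x \<and> T x < l \<and> P x < r\<^sup>2}"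
    using x by (simp add: S_def)
  moreover have "open {x. 0 < T x \<and> T x < l \<and> P x < r\<^sup>2}"
    by (intro open_Collect_conj open_Collect_less contT contP continuous_on_const)
  ultimately obtain d where d: "d > 0" "ball x d \<subseteq> {x. 0 < T x \<and> T x < l \<and> P x < r\<^sup>2}"
    by (meson openE)
  have dS: "ball x d \<subseteq> S" using d(2) unfolding S_def by force
  \<comment> \<open>The gradient at \<open>x\<close> of the bent chord minus the penalty.\<close>
  define q where "q = (m - \<delta> / 2 * (l - 2 * T x) + 2 * k * T x) *\<^sub>R e - (2 * k) *\<^sub>R (x - a)"
  show False
  proof (rule no_test[OF _ e \<delta> d(1)])
    show "x \<in> B" "ball x d \<subseteq> B" using x SB dS by auto
    fix h :: 'a assume h: "norm h < d"
    define s where "s = e \<bullet> h"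
    have Txh: "T (x + h) = T x + s" by (simp add: T_def s_def inner_add_right inner_diff_right)
    have Pxh: "P (x + h) = P x + 2 * ((x - a) \<bullet> h) + (norm h)\<^sup>2 - 2 * T x * s - s\<^sup>2"
    proof -
      have "(norm (x + h - a))\<^sup>2 = (norm (x - a))\<^sup>2 + 2 * ((x - a) \<bullet> h) + (norm h)\<^sup>2"
        unfolding dot_square_norm[symmetric]
        by (simp add: inner_diff_left inner_diff_right inner_add_left inner_add_right inner_commute)
      then show ?thesis unfolding P_def Txh by (simp add: power2_eq_square algebra_simps)
    qed
    have qh: "q \<bullet> h = (m - \<delta> / 2 * (l - 2 * T x) + 2 * k * T x) * s - 2 * k * ((x - a) \<bullet> h)"
      by (simp add: q_def inner_diff_left s_def)
    have "x + h \<in> S" using h dS by (auto simp: dist_norm)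
    from min[OF this]
    have "v x - m * T x + \<delta> / 2 * (T x * (l - T x)) + k * P x \<le>
       v (x + h) - m * (T x + s) + \<delta> / 2 * ((T x + s) * (l - (T x + s)))
        + k * (P x + 2 * ((x - a) \<bullet> h) + (norm h)\<^sup>2 - 2 * T x * s - s\<^sup>2)"
      unfolding G_def Txh Pxh by simp
    then show "v x + q \<bullet> h + \<delta> / 2 * (e \<bullet> h)\<^sup>2 - k * ((norm h)\<^sup>2 - (e \<bullet> h)\<^sup>2) \<le> v (x + h)"
      unfolding qh s_def[symmetric] by (simp add: power2_eq_square algebra_simps)
  qed
qed

text \<open>A hyperplane separating the open hypograph of \<open>v\<close> from the point of the graph over \<open>y\<close>; it is not vertical
because \<open>y\<close> is an interior point.\<close>
lemma concave_on_supergradient: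
  fixes v :: "'a::euclidean_space \<Rightarrow> real"
  assumes v: "concave_on B v" and B: "open B" and y: "y \<in> B"
  obtains q where "\<And>x. x \<in> B \<Longrightarrow> v x \<le> v y + q \<bullet> (x - y)"
proof -
  define S where "S = {(x - y, s - v y) | x s. x \<in> B \<and> s < v x}"
  have "convex S"
  proof (rule convexI)
    fix X Y and a b :: real
    assume X: "X \<in> S" and Y: "Y \<in> S" and ab: "0 \<le> a" "0 \<le> b" "a + b = 1"
    obtain x1 s1 where 1: "X = (x1 - y, s1 - v y)" "x1 \<in> B" "s1 < v x1" using X S_def by blast
    obtain x2 s2 where 2: "Y = (x2 - y, s2 - v y)" "x2 \<in> B" "s2 < v x2" using Y S_def by blast
    have "a *\<^sub>R x1 + b *\<^sub>R x2 \<in> B"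
      using concave_on_imp_convex[OF v] 1 2 ab by (simp add: convex_def)
    moreover have "a * s1 + b * s2 < v (a *\<^sub>R x1 + b *\<^sub>R x2)"
    proof -
      have "a * s1 + b * s2 < a * v x1 + b * v x2"
      proof (cases "a = 0")
        case False
        then have "a * s1 < a * v x1" using ab 1 by simp
        moreover have "b * s2 \<le> b * v x2" using ab 2 by (simp add: mult_left_mono)
        ultimately show ?thesis by simp
      qed (use 2 ab in simp)
      also have "\<dots> \<le> v (a *\<^sub>R x1 + b *\<^sub>R x2)"
        using v 1 2 ab unfolding concave_on_iff by blast
      finally show ?thesis .
    qed
    moreover have "a *\<^sub>R X + b *\<^sub>R Y = (a *\<^sub>R x1 + b *\<^sub>R x2 - y, a * s1 + b * s2 - v y)"
    proof -
      have b: "b = 1 - a" using ab by simp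
      show ?thesis unfolding 1(1) 2(1) b by (simp add: algebra_simps)
    qed
    ultimately show "a *\<^sub>R X + b *\<^sub>R Y \<in> S" unfolding S_def by blast
  qed
  moreover have "0 \<notin> S" by (auto simp: S_def zero_prod_def)
  ultimately obtain A where A: "A \<noteq> 0" "\<And>X. X \<in> S \<Longrightarrow> 0 \<le> A \<bullet> X"
    using separating_hyperplane_set_0 by blast
  obtain a b where ab: "A = (a, b)" by (cases A)
  have sep: "0 \<le> a \<bullet> (x - y) + b * (s - v y)" if "x \<in> B" "s < v x" for x s
    using A(2)[of "(x - y, s - v y)"] that unfolding S_def ab by auto
  have "b \<le> 0" using sep[OF y, of "v y - 1"] by simp
  moreover have "b \<noteq> 0"
  proof
    assume b: "b = 0"
    then have a: "a \<noteq> 0" using A(1) ab by (simp add: zero_prod_def)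
    obtain d where d: "d > 0" "ball y d \<subseteq> B" using B y by (meson openE)
    define x where "x = y - (d / (2 * norm a)) *\<^sub>R a"
    have "x \<in> B" using d a by (intro subsetD[OF d(2)]) (simp add: x_def dist_norm)
    from sep[OF this, of "v x - 1"] have "d / (2 * norm a) * (a \<bullet> a) \<le> 0"
      using b by (simp add: x_def)
    moreover have "d / (2 * norm a) * (a \<bullet> a) > 0"
      using d a by (intro mult_pos_pos divide_pos_pos) auto
    ultimately show False by simp
  qed
  ultimately have b: "b < 0" by simp
  show ?thesis
  proof (rule that[of "a /\<^sub>R (- b)"])
    fix x assume x: "x \<in> B"
    show "v x \<le> v y + (a /\<^sub>R (- b)) \<bullet> (x - y)"
    proof (rule dense_ge)
      fix s assume "v y + (a /\<^sub>R - b) \<bullet> (x - y) < s"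
      show "v x \<le> s"
      proof (rule ccontr)
        assume "\<not> v x \<le> s"
        with sep[OF x, of s] have "0 \<le> a \<bullet> (x - y) + b * (s - v y)" by simp
        then show False using \<open>_ < s\<close> b by (simp add: field_simps)
      qed
    qed
  qed
qed

text \<open>By \<open>lipschitz_test_gradient_le\<close> the gradient term is at most \<open>L\<^sup>p\<close>, so that \<open>\<lambda>\<^sub>N(D\<^sup>2 u) \<le> c\<close> in the viscosity
sense.\<close>
lemma supersolution_semiconcave:
  fixes B :: "(real^'n) set"
  assumes super: "visc_supersolution \<Omega> p \<gamma> f u"
    and B: "open B" "convex B" "B \<subseteq> \<Omega>"
    and lip: "L-lipschitz_on B u" and p: "p \<ge> 0"
    and c: "\<And>x. x \<in> B \<Longrightarrow> L powr p + \<gamma> * u x - f x \<le> c"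
  shows "concave_on B (\<lambda>x. u x - c / 2 * (norm x)\<^sup>2)"
proof (rule concave_of_no_convex_test[OF B(1,2)])
  show "continuous_on B (\<lambda>x. u x - c / 2 * (norm x)\<^sup>2)"
    by (intro continuous_intros lipschitz_on_continuous_on[OF lip])
next
  fix x q e b k d
  assume x: "x \<in> B" and e: "norm (e :: real^'n) = 1" and b: "b > 0" and d: "d > 0" "ball x d \<subseteq> B"
    and test: "\<And>h. norm h < d \<Longrightarrow> u x - c / 2 * (norm x)\<^sup>2 + q \<bullet> h + b / 2 * (e \<bullet> h)\<^sup>2
        - k * ((norm h)\<^sup>2 - (e \<bullet> h)\<^sup>2) \<le> u (x + h) - c / 2 * (norm (x + h))\<^sup>2"
  have test': "u x + (q + c *\<^sub>R x) \<bullet> h + (b + c) / 2 * (e \<bullet> h)\<^sup>2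
        - (k - c / 2) * ((norm h)\<^sup>2 - (e \<bullet> h)\<^sup>2) \<le> u (x + h)" if "norm h < d" for h
  proof -
    have "(norm (x + h))\<^sup>2 = (norm x)\<^sup>2 + 2 * (x \<bullet> h) + (norm h)\<^sup>2"
      unfolding dot_square_norm[symmetric]
      by (simp add: inner_add_left inner_add_right inner_commute)
    then show ?thesis
      using test[OF that] by (simp add: inner_add_left algebra_simps add_divide_distrib diff_divide_distrib)
  qed
  have "norm (q + c *\<^sub>R x) \<le> L"
    by (rule lipschitz_test_gradient_le[OF lipschitz_on_subset[OF lip d(2)] d(1) e test'])
  then have "norm (q + c *\<^sub>R x) powr p \<le> L powr p"
    using p by (intro powr_mono2) auto
  moreover have "b + c \<le> norm (q + c *\<^sub>R x) powr p + \<gamma> * u x - f x"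
    using x B(3) by (intro supersolution_directional_test[OF super _ e d(1) test']) auto
  ultimately show False using c[OF x] b by linarith
qed

section \<open>The comparison principle\<close>

text \<open>The key to comparison with a subsolution that is only semicontinuous. Let \<open>L\<^sub>0\<close> be the infimum of the Lipschitz
constants of \<open>u\<close> on small balls around \<open>x\<^sub>0\<close>. On a small ball \<open>u\<close> is semiconcave with constant close to
\<open>L\<^sub>0\<^sup>p + \<gamma> u(x\<^sub>0) - f(x\<^sub>0)\<close>. This gives the required inequality as soon as the supergradient \<open>q\<close> at \<open>x\<^sub>0\<close>
has norm at least \<open>L\<^sub>0\<close>. Such a supergradient exists: by the choice of \<open>L\<^sub>0\<close> there are increments of slope
almost \<open>L\<^sub>0\<close> arbitrarily close to \<open>x\<^sub>0\<close>, semiconcavity turns them into supergradients of that norm, and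
supergradients converge along a subsequence.\<close>
lemma supersolution_superjet:
  fixes u :: "real^'n \<Rightarrow> real"
  assumes super: "visc_supersolution \<Omega> p \<gamma> f u" and \<Omega>: "open \<Omega>" and x0: "x0 \<in> \<Omega>"
    and f: "continuous_on \<Omega> f" and p: "p > 0"
    and R: "R > 0" "ball x0 R \<subseteq> \<Omega>" and lip: "L'-lipschitz_on (ball x0 R) u" and \<epsilon>: "\<epsilon> > 0"
  obtains q c d where "d > 0"
    and "\<And>h. norm h < d \<Longrightarrow> u (x0 + h) \<le> u x0 + q \<bullet> h + c / 2 * (norm h)\<^sup>2"
    and "c \<le> norm q powr p + \<gamma> * u x0 - f x0 + \<epsilon>"
proof -
  define Ls where "Ls = {L. \<exists>r>0. ball x0 r \<subseteq> \<Omega> \<and> L-lipschitz_on (ball x0 r) u}"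
  define L0 where "L0 = Inf Ls"
  have Ls_ne: "Ls \<noteq> {}" using R lip unfolding Ls_def by blast
  have Ls_nonneg: "L \<ge> 0" if "L \<in> Ls" for L
    using that lipschitz_on_nonneg unfolding Ls_def by blast
  then have bdd: "bdd_below Ls" by (rule bdd_belowI)
  have L0: "L0 \<ge> 0" unfolding L0_def using Ls_ne Ls_nonneg by (rule cInf_greatest)
  have "((\<lambda>t. (L0 + t) powr p) \<longlongrightarrow> (L0 + 0) powr p) (at_right 0)"
    by (intro tendsto_powr' tendsto_intros) (use p L0 in \<open>auto intro!: eventually_at_right_less[THEN eventually_mono]\<close>)
  then have "\<forall>\<^sub>F t in at_right 0. (L0 + t) powr p < L0 powr p + \<epsilon> / 2"
    using \<epsilon> by (intro order_tendstoD) auto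
  then obtain \<eta> where \<eta>: "\<eta> > 0" "\<And>t. 0 < t \<Longrightarrow> t < \<eta> \<Longrightarrow> (L0 + t) powr p < L0 powr p + \<epsilon> / 2"
    unfolding eventually_at_right_field by blast
  obtain L where L: "L \<in> Ls" "L < L0 + \<eta> / 2"
    using cInf_lessD[OF Ls_ne, of "L0 + \<eta> / 2"] \<eta> unfolding L0_def by auto
  have Lp: "L powr p \<le> L0 powr p + \<epsilon> / 2"
    using powr_mono2[of p L "L0 + \<eta> / 2"] \<eta>(2)[of "\<eta> / 2"] \<eta>(1) L Ls_nonneg[OF L(1)] p by simp
  obtain r0 where r0: "r0 > 0" "ball x0 r0 \<subseteq> \<Omega>" "L-lipschitz_on (ball x0 r0) u"
    using L unfolding Ls_def by blast
  have uc: "isCont u x0"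
    using lipschitz_on_continuous_on[OF r0(3)] r0(1) by (simp add: continuous_on_eq_continuous_at)
  have fc: "isCont f x0" using f \<Omega> x0 by (simp add: continuous_on_eq_continuous_at)
  have "isCont (\<lambda>x. \<gamma> * u x - f x) x0" by (intro continuous_intros uc fc)
  then obtain r1 where r1: "r1 > 0"
      "\<And>x. dist x x0 < r1 \<Longrightarrow> dist (\<gamma> * u x - f x) (\<gamma> * u x0 - f x0) < \<epsilon> / 2"
    unfolding continuous_at_eps_delta using \<epsilon> by (metis half_gt_zero)
  define r where "r = min r0 r1"
  define B where "B = ball x0 r"
  have r: "r > 0" using r0 r1 by (simp add: r_def)
  have B: "open B" "convex B" "B \<subseteq> \<Omega>" "x0 \<in> B"
    using r r0(2) by (auto simp: B_def r_def)
  have lipB: "L-lipschitz_on B u"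
    by (rule lipschitz_on_subset[OF r0(3)]) (auto simp: B_def r_def)
  define c where "c = L0 powr p + \<gamma> * u x0 - f x0 + \<epsilon>"
  have "L powr p + \<gamma> * u x - f x \<le> c" if "x \<in> B" for x
  proof -
    have "\<bar>\<gamma> * u x - f x - (\<gamma> * u x0 - f x0)\<bar> < \<epsilon> / 2"
      using r1(2)[of x] that by (simp add: B_def r_def dist_commute[of x0 x] dist_real_def)
    then show ?thesis using Lp unfolding c_def by linarith
  qed
  then have concave: "concave_on B (\<lambda>x. u x - c / 2 * (norm x)\<^sup>2)"
    using p by (intro supersolution_semiconcave[OF super B(1,2,3) lipB]) auto
  have superjet: "\<exists>q. \<forall>x\<in>B. u x \<le> u y + q \<bullet> (x - y) + c / 2 * (norm (x - y))\<^sup>2" if y: "y \<in> B" for y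
  proof -
    obtain q where q: "\<And>x. x \<in> B \<Longrightarrow>
        u x - c / 2 * (norm x)\<^sup>2 \<le> u y - c / 2 * (norm y)\<^sup>2 + q \<bullet> (x - y)"
      using concave_on_supergradient[OF concave B(1) y] by blast
    have "u x \<le> u y + (q + c *\<^sub>R y) \<bullet> (x - y) + c / 2 * (norm (x - y))\<^sup>2" if "x \<in> B" for x
    proof -
      have eq: "(norm x)\<^sup>2 = (norm y)\<^sup>2 + 2 * (y \<bullet> (x - y)) + (norm (x - y))\<^sup>2"
        unfolding dot_square_norm[symmetric]
        by (simp add: inner_diff_left inner_diff_right inner_commute)
      have "c / 2 * (norm x)\<^sup>2 =
          c / 2 * (norm y)\<^sup>2 + c * (y \<bullet> (x - y)) + c / 2 * (norm (x - y))\<^sup>2"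
        unfolding eq by (simp add: distrib_left)
      moreover have "(q + c *\<^sub>R y) \<bullet> (x - y) = q \<bullet> (x - y) + c * (y \<bullet> (x - y))"
        by (simp add: inner_add_left)
      ultimately show ?thesis using q[OF that] by linarith
    qed
    then show ?thesis by blast
  qed
  \<comment> \<open>Supergradients at nearby points with norm almost \<open>L0\<close>. For \<open>L0 < s\<close> any
    supergradient at \<open>x0\<close> does; this case is separate because Lipschitz constants are
    nonnegative by definition.\<close>
  have steep: "\<exists>y q. dist y x0 < s \<and> norm q \<le> L \<and> L0 - (1 + \<bar>c\<bar>) * s \<le> norm q \<and>
      (\<forall>x\<in>B. u x \<le> u y + q \<bullet> (x - y) + c / 2 * (norm (x - y))\<^sup>2)" if s: "0 < s" "s \<le> r / 2" for s
  proof -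
    have "\<exists>y q. dist y x0 < s \<and> L0 - (1 + \<bar>c\<bar>) * s \<le> norm q \<and>
        (\<forall>x\<in>B. u x \<le> u y + q \<bullet> (x - y) + c / 2 * (norm (x - y))\<^sup>2)"
    proof (cases "L0 - s < 0")
      case True
      obtain q where "\<forall>x\<in>B. u x \<le> u x0 + q \<bullet> (x - x0) + c / 2 * (norm (x - x0))\<^sup>2"
        using superjet[OF B(4)] by blast
      moreover have "L0 - (1 + \<bar>c\<bar>) * s \<le> norm q"
      proof -
        have "\<bar>c\<bar> * s \<ge> 0" using s by simp
        then have "L0 - (1 + \<bar>c\<bar>) * s \<le> 0" using True by (simp add: algebra_simps)
        then show ?thesis using norm_ge_zero order_trans by blast
      qed
      ultimately show ?thesis using s by (intro exI[of _ x0] exI[of _ q]) auto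
    next
      case False
      have sub: "ball x0 s \<subseteq> B" using s r by (auto simp: B_def)
      have "\<not> (L0 - s)-lipschitz_on (ball x0 s) u"
      proof
        assume "(L0 - s)-lipschitz_on (ball x0 s) u"
        then have "L0 - s \<in> Ls" using s sub B(3) unfolding Ls_def by blast
        then show False using cInf_lower[OF _ bdd, of "L0 - s"] s by (simp add: L0_def)
      qed
      then obtain x y where xy: "x \<in> ball x0 s" "y \<in> ball x0 s"
          and gt: "(L0 - s) * dist x y < dist (u x) (u y)"
        using False unfolding lipschitz_on_def by (auto simp: not_le)
      obtain x y where xy: "x \<in> ball x0 s" "y \<in> ball x0 s"
          and gt: "(L0 - s) * dist x y < u x - u y"
      proof (cases "u y \<le> u x")
        case True
        then show ?thesis using that[of x y] xy gt by (simp add: dist_real_def)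
      next
        case False
        then show ?thesis using that[of y x] xy gt by (simp add: dist_real_def dist_commute)
      qed
      obtain q where q: "\<forall>x\<in>B. u x \<le> u y + q \<bullet> (x - y) + c / 2 * (norm (x - y))\<^sup>2"
        using superjet xy sub by blast
      have pos: "norm (x - y) > 0" using gt by (cases "x = y") auto
      have small: "norm (x - y) < 2 * s"
        using dist_triangle_less_add[of x x0 s y s] xy by (simp add: dist_norm norm_minus_commute[of x0])
      have "u x \<le> u y + q \<bullet> (x - y) + c / 2 * (norm (x - y))\<^sup>2" using q xy sub by blast
      then have "(L0 - s) * norm (x - y) < q \<bullet> (x - y) + c / 2 * (norm (x - y))\<^sup>2"
        using gt unfolding dist_norm by linarith
      also have "\<dots> \<le> norm q * norm (x - y) + \<bar>c\<bar> / 2 * (norm (x - y))\<^sup>2"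
        by (intro add_mono norm_cauchy_schwarz mult_right_mono) auto
      also have "\<dots> = (norm q + \<bar>c\<bar> / 2 * norm (x - y)) * norm (x - y)"
        by (simp add: power2_eq_square algebra_simps)
      finally have "L0 - s < norm q + \<bar>c\<bar> / 2 * norm (x - y)"
        using pos by (simp add: mult_less_cancel_right_pos)
      also have "\<bar>c\<bar> / 2 * norm (x - y) \<le> \<bar>c\<bar> / 2 * (2 * s)"
        using small by (intro mult_left_mono) auto
      finally have "L0 - (1 + \<bar>c\<bar>) * s \<le> norm q" by (simp add: algebra_simps)
      then show ?thesis using q xy by (intro exI[of _ y] exI[of _ q]) (auto simp: dist_commute)
    qed
    then obtain y q where y: "dist y x0 < s" and q: "L0 - (1 + \<bar>c\<bar>) * s \<le> norm q"
        "\<forall>x\<in>B. u x \<le> u y + q \<bullet> (x - y) + c / 2 * (norm (x - y))\<^sup>2" by blast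
    have ball: "ball y (r / 2) \<subseteq> B"
    proof
      fix x assume "x \<in> ball y (r / 2)"
      then show "x \<in> B" using dist_triangle[of x0 x y] y s by (simp add: B_def dist_commute)
    qed
    \<comment> \<open>The paraboloid touches \<open>u\<close> from above, so that its negative touches \<open>- u\<close> from
      below; the unit vector is arbitrary since the Hessian is a multiple of the
      identity.\<close>
    have "norm (- q) \<le> L"
    proof (rule lipschitz_test_gradient_le[where u = "\<lambda>x. - u x" and x = y and d = "r / 2"
          and b = "- c" and k = "c / 2" and e = "axis undefined 1"])
      show "L-lipschitz_on (ball y (r / 2)) (\<lambda>x. - u x)"
        using lipschitz_on_subset[OF lipB ball] by (simp add: lipschitz_on_def dist_minus)
      show "- u y + - q \<bullet> h + - c / 2 * (axis undefined 1 \<bullet> h)\<^sup>2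
          - c / 2 * ((norm h)\<^sup>2 - (axis undefined 1 \<bullet> h)\<^sup>2) \<le> - u (y + h)" if "norm h < r / 2" for h
      proof -
        have "y + h \<in> B" using ball that by (auto simp: dist_norm)
        then have "u (y + h) \<le> u y + q \<bullet> (y + h - y) + c / 2 * (norm (y + h - y))\<^sup>2"
          using q(2) by blast
        then show ?thesis by (simp add: algebra_simps)
      qed
    qed (use r in \<open>auto simp: norm_axis_1\<close>)
    then show ?thesis using y q by auto
  qed
  define s where "s n = r / 2 * inverse (real (Suc n))" for n
  have s: "0 < s n \<and> s n \<le> r / 2" for n using r by (simp add: s_def field_simps)
  have s_lim: "s \<longlonglongrightarrow> 0"
    unfolding s_def by (rule tendsto_mult_right_zero[OF LIMSEQ_inverse_real_of_nat])
  have "\<exists>y q. dist y x0 < s n \<and> norm q \<le> L \<and> L0 - (1 + \<bar>c\<bar>) * s n \<le> norm q \<and>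
      (\<forall>x\<in>B. u x \<le> u y + q \<bullet> (x - y) + c / 2 * (norm (x - y))\<^sup>2)" for n
    using s[of n] by (intro steep) auto
  then obtain y q where "\<And>n. dist (y n) x0 < s n \<and> norm (q n) \<le> L \<and>
      L0 - (1 + \<bar>c\<bar>) * s n \<le> norm (q n) \<and>
      (\<forall>x\<in>B. u x \<le> u (y n) + q n \<bullet> (x - y n) + c / 2 * (norm (x - y n))\<^sup>2)"
    by metis
  then have yq: "\<And>n. dist (y n) x0 < s n" "\<And>n. norm (q n) \<le> L"
      "\<And>n. L0 - (1 + \<bar>c\<bar>) * s n \<le> norm (q n)"
      "\<And>n x. x \<in> B \<Longrightarrow> u x \<le> u (y n) + q n \<bullet> (x - y n) + c / 2 * (norm (x - y n))\<^sup>2"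
    by blast+
  have "\<forall>n. q n \<in> cball 0 L" using yq(2) by simp
  then obtain Q \<sigma> where \<sigma>: "strict_mono \<sigma>" and Q: "(q \<circ> \<sigma>) \<longlonglongrightarrow> Q"
    using compact_cball[of 0 L] unfolding compact_def by blast
  have "y \<longlonglongrightarrow> x0"
  proof (rule metric_tendsto_imp_tendsto[OF s_lim always_eventually], rule allI)
    show "dist (y n) x0 \<le> dist (s n) 0" for n using yq(1)[of n] by simp
  qed
  then have y\<sigma>: "(\<lambda>n. y (\<sigma> n)) \<longlonglongrightarrow> x0" using LIMSEQ_subseq_LIMSEQ[OF _ \<sigma>] by (simp add: o_def)
  have s\<sigma>: "(\<lambda>n. s (\<sigma> n)) \<longlonglongrightarrow> 0" using LIMSEQ_subseq_LIMSEQ[OF s_lim \<sigma>] by (simp add: o_def)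
  have Q': "(\<lambda>n. q (\<sigma> n)) \<longlonglongrightarrow> Q" using Q by (simp add: o_def)
  have jet: "u x \<le> u x0 + Q \<bullet> (x - x0) + c / 2 * (norm (x - x0))\<^sup>2" if "x \<in> B" for x
  proof (rule tendsto_lowerbound)
    show "(\<lambda>n. u (y (\<sigma> n)) + q (\<sigma> n) \<bullet> (x - y (\<sigma> n)) + c / 2 * (norm (x - y (\<sigma> n)))\<^sup>2)
        \<longlonglongrightarrow> u x0 + Q \<bullet> (x - x0) + c / 2 * (norm (x - x0))\<^sup>2"
      by (intro tendsto_intros isCont_tendsto_compose[OF uc] y\<sigma> Q')
  qed (use yq(4) that in auto)
  have QL: "L0 - (1 + \<bar>c\<bar>) * 0 \<le> norm Q"
    by (rule tendsto_le[OF _ tendsto_norm[OF Q'] tendsto_diff[OF tendsto_const tendsto_mult[OF tendsto_const s\<sigma>]]])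
      (use yq(3) in auto)
  show ?thesis
  proof (rule that[OF r])
    show "u (x0 + h) \<le> u x0 + Q \<bullet> h + c / 2 * (norm h)\<^sup>2" if "norm h < r" for h
      using jet[of "x0 + h"] that by (simp add: B_def dist_norm)
    show "c \<le> norm Q powr p + \<gamma> * u x0 - f x0 + \<epsilon>"
      using powr_mono2[of p L0 "norm Q"] QL L0 p by (simp add: c_def)
  qed
qed

text \<open>If no point were a maximum, every point would have a neighbourhood on which \<open>g\<close> stays below some value of
\<open>g\<close>; finitely many of these neighbourhoods cover \<open>K\<close>, and a point where the largest of the corresponding
values is taken lies in none of them.\<close>
lemma usc_attains_max:
  fixes g :: "'a::topological_space \<Rightarrow> real"
  assumes K: "compact K" "K \<noteq> {}"
    and usc: "\<And>x c. x \<in> K \<Longrightarrow> g x < c \<Longrightarrow> \<forall>\<^sub>F y in at x within K. g y < c"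
  obtains x where "x \<in> K" "\<And>y. y \<in> K \<Longrightarrow> g y \<le> g x"
proof (rule ccontr)
  assume "\<not> thesis"
  then have "\<forall>x\<in>K. \<exists>y\<in>K. g x < g y" using that by (meson not_le)
  then obtain Y where Y: "\<And>x. x \<in> K \<Longrightarrow> Y x \<in> K \<and> g x < g (Y x)" by metis
  have "\<exists>U. open U \<and> x \<in> U \<and> (\<forall>y\<in>U \<inter> K. g y < g (Y x))" if x: "x \<in> K" for x
  proof -
    have ev: "\<forall>\<^sub>F y in at x within K. g y < g (Y x)" using usc Y x by blast
    then obtain U where "open U" "x \<in> U" "\<And>y. y \<in> U \<Longrightarrow> y \<noteq> x \<Longrightarrow> y \<in> K \<Longrightarrow> g y < g (Y x)"
      unfolding eventually_at_topological by blast
    then show ?thesis using Y[OF x] by (intro exI[of _ U]) auto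
  qed
  then obtain U where U: "\<And>x. x \<in> K \<Longrightarrow> open (U x) \<and> x \<in> U x \<and> (\<forall>y\<in>U x \<inter> K. g y < g (Y x))"
    by metis
  have "K \<subseteq> (\<Union>x\<in>K. U x)" using U by blast
  then obtain F where F: "F \<subseteq> K" "finite F" "K \<subseteq> (\<Union>x\<in>F. U x)"
    by (rule compactE_image[OF K(1), rotated]) (use U in auto)
  have "F \<noteq> {}" using F K by auto
  then have "Max ((\<lambda>x. g (Y x)) ` F) \<in> (\<lambda>x. g (Y x)) ` F" using F by (intro Max_in) auto
  then obtain a where a: "a \<in> F" "g (Y a) = Max ((\<lambda>x. g (Y x)) ` F)" by auto
  obtain b where b: "b \<in> F" "Y a \<in> U b" using F Y a by blast
  have "g (Y a) < g (Y b)" using U[of b] b F Y[of a] a by blast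
  also have "\<dots> \<le> g (Y a)" unfolding a(2) using F b by (intro Max_ge) auto
  finally show False by simp
qed

text \<open>At a maximum point \<open>x\<^sub>0\<close> of \<open>w - u\<close> a paraboloid touching \<open>u\<close> from above at \<open>x\<^sub>0\<close> also touches \<open>w\<close> from above,
up to a constant. Testing \<open>w\<close> with the one from \<open>supersolution_superjet\<close> leaves
\<open>\<gamma> (w - u)(x\<^sub>0) \<le> \<epsilon>\<close>.\<close>
lemma comparison_principle:
  fixes u w :: "real^'n \<Rightarrow> real"
  assumes \<Omega>: "open \<Omega>" "bounded \<Omega>" and p: "p > 0" and \<gamma>: "\<gamma> > 0" and f: "continuous_on \<Omega> f"
    and super: "visc_supersolution \<Omega> p \<gamma> f u" and u: "continuous_on (closure \<Omega>) u"
    and lip: "\<And>x. x \<in> \<Omega> \<Longrightarrow> \<exists>R L. R > 0 \<and> ball x R \<subseteq> \<Omega> \<and> L-lipschitz_on (ball x R) u"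
    and sub: "visc_subsolution \<Omega> p \<gamma> f w" and w: "usc_on (closure \<Omega>) w"
    and bd: "\<And>x. x \<in> frontier \<Omega> \<Longrightarrow> w x \<le> u x"
    and x: "x \<in> closure \<Omega>"
  shows "w x \<le> u x"
proof -
  have K: "compact (closure \<Omega>)" "closure \<Omega> \<noteq> {}" using \<Omega> x by auto
  obtain x0 where x0: "x0 \<in> closure \<Omega>" and max: "\<And>y. y \<in> closure \<Omega> \<Longrightarrow> w y - u y \<le> w x0 - u x0"
  proof (rule usc_attains_max[OF K, of "\<lambda>y. w y - u y"])
    fix z c assume z: "z \<in> closure \<Omega>" and c: "w z - u z < c"
    define m where "m = (c - (w z - u z)) / 2"
    have m: "m > 0" using c by (simp add: m_def)
    have "\<forall>\<^sub>F y in at z within closure \<Omega>. w y < w z + m"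
      using w z m unfolding usc_on_def by simp
    moreover have "\<forall>\<^sub>F y in at z within closure \<Omega>. u z - m < u y"
      using u z m by (intro order_tendstoD) (auto simp: continuous_on_def)
    ultimately show "\<forall>\<^sub>F y in at z within closure \<Omega>. w y - u y < c"
    proof eventually_elim
      case (elim y)
      then show ?case unfolding m_def by (simp add: field_simps)
    qed
  qed blast
  have "w x0 - u x0 \<le> 0"
  proof (rule ccontr)
    assume "\<not> w x0 - u x0 \<le> 0"
    then have gt: "w x0 - u x0 > 0" by simp
    then have x0\<Omega>: "x0 \<in> \<Omega>"
      using bd[of x0] x0 \<Omega>(1) by (auto simp: frontier_def interior_open)
    define \<epsilon> where "\<epsilon> = \<gamma> * (w x0 - u x0) / 2"
    have \<epsilon>: "\<epsilon> > 0" using gt \<gamma> by (simp add: \<epsilon>_def)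
    obtain R L where R: "R > 0" "ball x0 R \<subseteq> \<Omega>" and L: "L-lipschitz_on (ball x0 R) u"
      using lip[OF x0\<Omega>] by blast
    obtain q c d where d: "d > 0"
        and jet: "\<And>h. norm h < d \<Longrightarrow> u (x0 + h) \<le> u x0 + q \<bullet> h + c / 2 * (norm h)\<^sup>2"
        and c: "c \<le> norm q powr p + \<gamma> * u x0 - f x0 + \<epsilon>"
      by (rule supersolution_superjet[OF super \<Omega>(1) x0\<Omega> f p R L \<epsilon>]) (rule that)
    have "norm q powr p + \<gamma> * w x0 - f x0 \<le> c"
    proof (rule subsolution_paraboloid_test[OF sub x0\<Omega> d])
      fix h assume h: "norm h < d" "x0 + h \<in> \<Omega>"
      then show "w (x0 + h) \<le> w x0 + q \<bullet> h + c / 2 * (norm h)\<^sup>2"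
        using jet[OF h(1)] max[of "x0 + h"] closure_subset[of \<Omega>] by force
    qed
    then have "\<gamma> * (w x0 - u x0) \<le> \<epsilon>" using c by (simp add: algebra_simps)
    then show False using \<epsilon> unfolding \<epsilon>_def by simp
  qed
  then show ?thesis using max[OF x] by simp
qed

lemma usc_on_diff_const:
  assumes "usc_on S u" shows "usc_on S (\<lambda>x. u x - c)"
  unfolding usc_on_def
proof (intro ballI allI impI)
  fix x b assume "x \<in> S" "u x - c < b"
  then have "\<forall>\<^sub>F y in at x within S. u y < b + c"
    using assms unfolding usc_on_def by auto
  then show "\<forall>\<^sub>F y in at x within S. u y - c < b" by eventually_elim simp
qed

lemma visc_subsolution_shift:
  assumes sub: "visc_subsolution \<Omega> p 0 f w" and \<gamma>: "\<gamma> \<ge> 0" and C: "\<And>x. x \<in> \<Omega> \<Longrightarrow> w x \<le> C"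
  shows "visc_subsolution \<Omega> p \<gamma> f (\<lambda>x. w x - C)"
  unfolding visc_subsolution_def
proof (intro conjI allI impI)
  show "usc_on \<Omega> (\<lambda>x. w x - C)"
    using sub unfolding visc_subsolution_def by (intro usc_on_diff_const) simp
next
  fix \<phi> D\<phi> D2\<phi> x
  assume C2: "C2_on \<Omega> \<phi> D\<phi> D2\<phi>" and max: "local_max_at \<Omega> (\<lambda>y. w y - C - \<phi> y) x"
  have "local_max_at \<Omega> (\<lambda>y. w y - \<phi> y) x" using max by (auto simp: local_max_at_def)
  with sub C2 have "- lambda_max (D2\<phi> x) + norm (D\<phi> x) powr p \<le> f x"
    unfolding visc_subsolution_def by force
  moreover have "\<gamma> * (w x - C) \<le> 0"
    using C[of x] max \<gamma> by (auto simp: local_max_at_def intro: mult_nonneg_nonpos)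
  ultimately show "- lambda_max (D2\<phi> x) + norm (D\<phi> x) powr p + \<gamma> * (w x - C) \<le> f x" by linarith
qed

section \<open>Exterior balls and the upper barrier\<close>

text \<open>The place where \<open>p > 1\<close> is used: \<open>K\<^sup>p\<close> grows faster than \<open>K\<close>.\<close>
lemma exists_barrier_slope:
  fixes R F p :: real
  assumes "R > 0" "p > 1"
  obtains K where "K > 0" "K powr p - K / R > F"
proof -
  define A where "A = 1 / R + \<bar>F\<bar> + 1"
  have A: "A \<ge> 1" using assms by (simp add: A_def)
  define K where "K = A powr (1 / (p - 1))"
  have K: "K \<ge> 1" unfolding K_def using A assms by (intro ge_one_powr_ge_zero) auto
  have "K powr (p - 1) = A" unfolding K_def using A assms by (simp add: powr_powr)
  moreover have "K powr p = K powr (p - 1) * K powr 1"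
    unfolding powr_add[symmetric] by simp
  ultimately have "K powr p = A * K" using K by simp
  then have "K powr p - K / R = K * (\<bar>F\<bar> + 1)" by (simp add: A_def algebra_simps)
  also have "\<dots> \<ge> 1 * (\<bar>F\<bar> + 1)" using K by (intro mult_right_mono) auto
  finally have "K powr p - K / R \<ge> \<bar>F\<bar> + 1" by simp
  then show ?thesis using that[of K] K by simp
qed

text \<open>The cone \<open>x \<mapsto> K (|x - y| - R)\<close> is a strict supersolution outside \<open>ball y R\<close>. Instead of differentiating
the norm, the proof tests with the paraboloid that touches the cone from above at the maximum point; it
has the same gradient and Hessian \<open>(K / s) I\<close>, where \<open>s\<close> is the distance to \<open>y\<close>.\<close>
lemma subsolution_le_cone:
  fixes \<Omega> :: "(real^'n) set"
  assumes \<Omega>: "open \<Omega>" "bounded \<Omega>"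
    and sub: "visc_subsolution \<Omega> p \<gamma> f u" and u: "continuous_on (closure \<Omega>) u"
    and bd: "\<And>x. x \<in> frontier \<Omega> \<Longrightarrow> u x \<le> 0" and \<gamma>: "\<gamma> \<ge> 0"
    and R: "R > 0" and y: "\<And>x. x \<in> \<Omega> \<Longrightarrow> R \<le> dist x y"
    and K: "K > 0" "K powr p - K / R > F" and F: "\<And>x. x \<in> \<Omega> \<Longrightarrow> f x \<le> F"
    and x: "x \<in> closure \<Omega>"
  shows "u x \<le> K * (dist x y - R)"
proof -
  define G where "G x = u x - K * (dist x y - R)" for x
  have K': "compact (closure \<Omega>)" "closure \<Omega> \<noteq> {}" using \<Omega>(2) x by auto
  have "continuous_on (closure \<Omega>) G" unfolding G_def by (intro continuous_intros u)
  then obtain a where a: "a \<in> closure \<Omega>" and max: "\<And>x. x \<in> closure \<Omega> \<Longrightarrow> G x \<le> G a"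
    using continuous_attains_sup[OF K'] by blast
  have "closure \<Omega> \<subseteq> {x. R \<le> dist x y}"
    using y by (intro closure_minimal closed_Collect_le continuous_intros) auto
  then have Ra: "R \<le> dist a y" using a by blast
  have "G a \<le> 0"
  proof (rule ccontr)
    assume "\<not> G a \<le> 0"
    moreover have "K * (dist a y - R) \<ge> 0" using K Ra by simp
    ultimately have ua: "u a > 0" by (simp add: G_def)
    have a\<Omega>: "a \<in> \<Omega>" using bd[of a] ua a \<Omega>(1) by (auto simp: frontier_def interior_open)
    define s where "s = dist a y"
    have s: "s > 0" using R Ra unfolding s_def by linarith
    have "norm ((K / s) *\<^sub>R (a - y)) powr p + \<gamma> * u a - f a \<le> K / s"
    proof (rule subsolution_paraboloid_test[OF sub a\<Omega> zero_less_one])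
      fix h assume h: "norm h < 1" "a + h \<in> \<Omega>"
      \<comment> \<open>The inequality \<open>2 s t \<le> t\<^sup>2 + s\<^sup>2\<close> with \<open>t = |a + h - y|\<close> puts a paraboloid
        above the cone.\<close>
      have "0 \<le> (dist (a + h) y - s)\<^sup>2" by simp
      moreover have "(dist (a + h) y)\<^sup>2 = s\<^sup>2 + 2 * ((a - y) \<bullet> h) + (norm h)\<^sup>2"
        unfolding s_def dist_norm dot_square_norm[symmetric]
        by (simp add: inner_diff_left inner_diff_right inner_add_left inner_add_right inner_commute)
      ultimately have "2 * (s * (dist (a + h) y - s)) \<le> 2 * ((a - y) \<bullet> h) + (norm h)\<^sup>2"
        by (simp add: power2_eq_square algebra_simps)
      then have "K / (2 * s) * (2 * (s * (dist (a + h) y - s)))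
          \<le> K / (2 * s) * (2 * ((a - y) \<bullet> h) + (norm h)\<^sup>2)"
        using K s by (intro mult_left_mono) auto
      moreover have "K / (2 * s) * (2 * (s * (dist (a + h) y - s))) = K * (dist (a + h) y - s)"
        using s by simp
      moreover have "K / (2 * s) * (2 * ((a - y) \<bullet> h) + (norm h)\<^sup>2)
          = ((K / s) *\<^sub>R (a - y)) \<bullet> h + K / s / 2 * (norm h)\<^sup>2"
        unfolding inner_scaleR_left by (simp add: distrib_left)
      ultimately have "K * (dist (a + h) y - s) \<le> ((K / s) *\<^sub>R (a - y)) \<bullet> h + K / s / 2 * (norm h)\<^sup>2"
        by linarith
      moreover have "G (a + h) \<le> G a" using max[of "a + h"] h closure_subset[of \<Omega>] by blast
      ultimately show "u (a + h) \<le> u a + ((K / s) *\<^sub>R (a - y)) \<bullet> h + K / s / 2 * (norm h)\<^sup>2"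
        by (simp add: G_def s_def algebra_simps)
    qed
    moreover have Kq: "norm ((K / s) *\<^sub>R (a - y)) = K" using K s by (simp add: s_def dist_norm)
    moreover have "K / s \<le> K / R" using K R Ra       using s by (intro divide_left_mono) (auto simp: s_def)
    moreover have "\<gamma> * u a \<ge> 0" using \<gamma> ua by simp
    ultimately show False using K(2) F[OF a\<Omega>] unfolding Kq by linarith
  qed
  then show ?thesis using max[OF x] by (simp add: G_def)
qed

text \<open>If \<open>\<Omega>\<close> lies above the graph of \<open>g\<close> and \<open>D\<^sup>2 g\<close> is bounded by \<open>M\<close>, then at a boundary point \<open>z\<close> the set \<open>\<Omega>\<close>
lies above a paraboloid of curvature \<open>M\<close>, and a ball of radius at most \<open>1 / (2 M)\<close> fits below it. The
vector \<open>\<nu> - Dg z\<close> is an inner normal; its norm is at least \<open>1\<close> because \<open>g\<close> is constant along \<open>\<nu>\<close>.\<close>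
lemma local_exterior_ball:
  fixes \<Omega> :: "(real^'n) set"
  assumes \<Omega>: "open \<Omega>" "C2_boundary \<Omega>" and z0: "z0 \<in> frontier \<Omega>"
  shows "\<exists>\<rho>>0. \<exists>R0>0. \<forall>z\<in>frontier \<Omega> \<inter> ball z0 \<rho>. \<forall>R. 0 < R \<and> R \<le> R0 \<longrightarrow>
    (\<exists>y. dist z y = R \<and> (\<forall>x\<in>\<Omega>. R \<le> dist x y))"
proof -
  from bspec[OF \<Omega>(2)[unfolded C2_boundary_def] z0]
  obtain r \<nu> g Dg D2g where r: "r > 0" and \<nu>: "norm \<nu> = 1" and C2: "C2_on UNIV g Dg D2g"
      and g\<nu>: "\<forall>x t. g (x + t *\<^sub>R \<nu>) = g x" and graph: "\<Omega> \<inter> ball z0 r = {x \<in> ball z0 r. g x < x \<bullet> \<nu>}"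
    by (elim exE conjE) (rule that)
  obtain M where M: "M > 0" and low: "\<And>x z. x \<in> cball z0 r \<Longrightarrow> z \<in> cball z0 r \<Longrightarrow>
      g z + Dg z \<bullet> (x - z) - M * (norm (x - z))\<^sup>2 \<le> g x"
    by (rule C2_lower_quadratic_bound[OF C2, of z0 r]) (rule that)
  have tangent: "Dg z \<bullet> \<nu> = 0" for z
  proof -
    have "(g has_derivative (\<lambda>h. Dg z \<bullet> h)) (at (z + 0 *\<^sub>R \<nu>))" using C2 unfolding C2_on_def by simp
    then have "((\<lambda>t. g (z + t *\<^sub>R \<nu>)) has_derivative (\<lambda>t. Dg z \<bullet> (t *\<^sub>R \<nu>))) (at 0)"
      by (intro has_derivative_compose[where g = g and f' = "\<lambda>t. t *\<^sub>R \<nu>"]) (auto intro!: derivative_eq_intros)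
    then have "((\<lambda>t::real. g z) has_derivative (\<lambda>t. Dg z \<bullet> (t *\<^sub>R \<nu>))) (at 0)" by (simp add: g\<nu>)
    from has_derivative_unique[OF this has_derivative_const]
    have "Dg z \<bullet> (1 *\<^sub>R \<nu>) = 0" by metis
    then show ?thesis by simp
  qed
  define R0 where "R0 = min (r / 4) (1 / (2 * M))"
  have R0: "R0 > 0" using r M by (simp add: R0_def)
  have "\<exists>y. dist z y = R \<and> (\<forall>x\<in>\<Omega>. R \<le> dist x y)"
    if z: "z \<in> frontier \<Omega>" "z \<in> ball z0 (r / 2)" and R: "0 < R" "R \<le> R0" for z R
  proof -
    define N where "N = \<nu> - Dg z"
    have "N \<bullet> \<nu> = 1" using \<nu> tangent[of z] by (simp add: N_def inner_diff_left norm_eq_1)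
    then have N: "norm N \<ge> 1" using norm_cauchy_schwarz[of N \<nu>] \<nu> by simp
    define n where "n = N /\<^sub>R norm N"
    have N0: "norm N > 0" using N by linarith
    then have n: "norm n = 1" by (simp add: n_def)
    have "z \<notin> \<Omega>" using z(1) \<Omega>(1) by (simp add: frontier_def interior_open)
    moreover have zr: "z \<in> ball z0 r" using z(2) r by simp
    ultimately have gz: "z \<bullet> \<nu> \<le> g z" using graph by force
    define y where "y = z - R *\<^sub>R n"
    have "R \<le> dist x y" if x: "x \<in> \<Omega>" for x
    proof (cases "x \<in> ball z0 r")
      case True
      then have gx: "g x < x \<bullet> \<nu>" using x graph by blast
      have "g z + Dg z \<bullet> (x - z) - M * (norm (x - z))\<^sup>2 \<le> g x"
        using True zr by (intro low) auto
      then have "- (M * (norm (x - z))\<^sup>2) \<le> N \<bullet> (x - z)"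
        using gx gz by (simp add: N_def inner_diff_left inner_diff_right inner_commute)
      moreover have "N \<bullet> (x - z) = norm N * (n \<bullet> (x - z))"
        using N0 by (simp add: n_def)
      ultimately have "- (M * (norm (x - z))\<^sup>2) \<le> norm N * (n \<bullet> (x - z))" by simp
      then have nx: "- (M * (norm (x - z))\<^sup>2) \<le> n \<bullet> (x - z)"
      proof (cases "n \<bullet> (x - z) \<ge> 0")
        case True
        moreover have "M * (norm (x - z))\<^sup>2 \<ge> 0" using M by simp
        ultimately show ?thesis by linarith
      next
        case False
        then have "norm N * (n \<bullet> (x - z)) \<le> 1 * (n \<bullet> (x - z))"
          using N by (intro mult_right_mono_neg) auto
        then show ?thesis using \<open>_ \<le> norm N * _\<close> by linarith
      qed
      have RM: "2 * R * M \<le> 1"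
      proof -
        have "R \<le> 1 / (2 * M)" using R by (simp add: R0_def)
        then show ?thesis using M by (simp add: field_simps)
      qed
      have "(dist x y)\<^sup>2 = (norm (x - z))\<^sup>2 + 2 * R * (n \<bullet> (x - z)) + R\<^sup>2"
      proof -
        have nn: "n \<bullet> n = 1" using n by (simp add: norm_eq_1)
        define w where "w = x - z"
        have xy: "x - y = w + R *\<^sub>R n" by (simp add: y_def w_def)
        show ?thesis
          unfolding dist_norm xy w_def[symmetric] dot_square_norm[symmetric]
          by (simp add: inner_add_left inner_add_right nn inner_commute[of w n] power2_eq_square distrib_left)
      qed
      moreover have "2 * R * (n \<bullet> (x - z)) \<ge> - (norm (x - z))\<^sup>2"
      proof -
        have "2 * R * - (M * (norm (x - z))\<^sup>2) \<le> 2 * R * (n \<bullet> (x - z))"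
          using nx R by (intro mult_left_mono) auto
        moreover have "2 * R * M * (norm (x - z))\<^sup>2 \<le> 1 * (norm (x - z))\<^sup>2"
          using RM by (intro mult_right_mono) auto
        moreover have "2 * R * - (M * (norm (x - z))\<^sup>2) = - (2 * R * M * (norm (x - z))\<^sup>2)"
          by simp
        ultimately show ?thesis by linarith
      qed
      ultimately have "R\<^sup>2 \<le> (dist x y)\<^sup>2" by linarith
      then show ?thesis by (rule power2_le_imp_le) simp
    next
      case False
      have "dist z y = R" using n R by (simp add: y_def dist_norm)
      moreover have "R \<le> r / 4" using R by (simp add: R0_def)
      moreover have "dist z0 x \<le> dist z0 z + dist z y + dist x y"
        using dist_triangle[of z0 x z] dist_triangle[of z x y] by (simp add: dist_commute)
      ultimately show ?thesis using False z(2) by simp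
    qed
    then show ?thesis using n R by (intro exI[of _ y]) (auto simp: y_def dist_norm)
  qed
  then show ?thesis using r R0 by (intro exI[of _ "r / 2"] conjI exI[of _ R0]) auto
qed

lemma uniform_exterior_ball:
  fixes \<Omega> :: "(real^'n) set"
  assumes \<Omega>: "open \<Omega>" "bounded \<Omega>" "C2_boundary \<Omega>"
  obtains R where "R > 0"
    and "\<And>z. z \<in> frontier \<Omega> \<Longrightarrow> \<exists>y. dist z y = R \<and> (\<forall>x\<in>\<Omega>. R \<le> dist x y)"
proof -
  obtain \<rho> R0 where \<rho>: "\<And>a. a \<in> frontier \<Omega> \<Longrightarrow> \<rho> a > 0" and R0: "\<And>a. a \<in> frontier \<Omega> \<Longrightarrow> R0 a > 0"
    and ball: "\<And>a z R. a \<in> frontier \<Omega> \<Longrightarrow> z \<in> frontier \<Omega> \<Longrightarrow> z \<in> ball a (\<rho> a) \<Longrightarrow> 0 < R \<Longrightarrow> R \<le> R0 a \<Longrightarrow>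
      \<exists>y. dist z y = R \<and> (\<forall>x\<in>\<Omega>. R \<le> dist x y)"
    using local_exterior_ball[OF \<Omega>(1,3)] by (metis IntI)
  have cpt: "compact (frontier \<Omega>)" using \<Omega>(2) by (simp add: compact_frontier_bounded)
  have cover: "frontier \<Omega> \<subseteq> (\<Union>a\<in>frontier \<Omega>. ball a (\<rho> a))" using \<rho> by force
  obtain T where T: "T \<subseteq> frontier \<Omega>" "finite T" "frontier \<Omega> \<subseteq> (\<Union>a\<in>T. ball a (\<rho> a))"
    by (rule compactE_image[OF cpt _ cover]) auto
  define R where "R = Min (insert 1 (R0 ` T))"
  have R: "R > 0" using T R0 by (auto simp: R_def)
  show ?thesis
  proof (rule that[OF R])
    fix z assume z: "z \<in> frontier \<Omega>"
    then obtain a where a: "a \<in> T" "z \<in> ball a (\<rho> a)" using T by blast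
    have "R \<le> R0 a" unfolding R_def using T a by (intro Min_le) auto
    then show "\<exists>y. dist z y = R \<and> (\<forall>x\<in>\<Omega>. R \<le> dist x y)" using ball z a T R by blast
  qed
qed

text \<open>The constant is uniform in \<open>\<gamma>\<close>: it depends on \<open>\<Omega>\<close>, \<open>p\<close> and an upper bound of \<open>f\<close> only.\<close>
lemma dirichlet_subsolution_le_dist_frontier:
  fixes \<Omega> :: "(real^'n) set"
  assumes \<Omega>: "bounded_C2_domain \<Omega>" and p: "p > 1"
  obtains K where "K > 0"
    and "\<And>\<gamma> f u x z. \<gamma> \<ge> 0 \<Longrightarrow> (\<forall>x\<in>\<Omega>. f x \<le> F) \<Longrightarrow> continuous_on (closure \<Omega>) u \<Longrightarrow>
      dirichlet_subsolution \<Omega> p \<gamma> f u \<Longrightarrow> x \<in> closure \<Omega> \<Longrightarrow> z \<in> frontier \<Omega> \<Longrightarrow> u x \<le> K * dist x z"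
proof -
  have \<Omega>': "open \<Omega>" "bounded \<Omega>" "C2_boundary \<Omega>" using \<Omega> by (auto simp: bounded_C2_domain_def)
  obtain R where R: "R > 0" and ball: "\<And>z. z \<in> frontier \<Omega> \<Longrightarrow> \<exists>y. dist z y = R \<and> (\<forall>x\<in>\<Omega>. R \<le> dist x y)"
    using uniform_exterior_ball[OF \<Omega>'] by metis
  obtain K where K: "K > 0" "K powr p - K / R > F" using exists_barrier_slope[OF R p] by metis
  show ?thesis
  proof (rule that[OF K(1)])
    fix \<gamma> f u x z
    assume \<gamma>: "\<gamma> \<ge> 0" and f: "\<forall>x\<in>\<Omega>. f x \<le> F" and u: "continuous_on (closure \<Omega>) u"
      and sub: "dirichlet_subsolution \<Omega> p \<gamma> f u" and x: "x \<in> closure \<Omega>" and z: "z \<in> frontier \<Omega>"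
    obtain y where y: "dist z y = R" "\<forall>x\<in>\<Omega>. R \<le> dist x y" using ball[OF z] by blast
    \<comment> \<open>The cone over the exterior ball at \<open>z\<close> vanishes at \<open>z\<close>.\<close>
    have "u x \<le> K * (dist x y - R)"
      using sub y(2) f unfolding dirichlet_subsolution_def
      by (intro subsolution_le_cone[OF \<Omega>'(1,2) _ u _ \<gamma> R _ K _ x]) auto
    also have "\<dots> \<le> K * dist x z"
      using K(1) y(1) dist_triangle[of x y z] by (intro mult_left_mono) auto
    finally show "u x \<le> K * dist x z" .
  qed
qed

section \<open>Lipschitz estimate for supersolutions\<close>

text \<open>Second-order Taylor bound with the coefficient \<open>1 / 2\<close> lowered to \<open>3 / 8\<close>, which leaves room for the
third-order term.\<close>
lemma ln_one_plus_le_quadratic: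
  fixes y :: real
  assumes "\<bar>y\<bar> \<le> 1 / 3"
  shows "ln (1 + y) \<le> y - 3 / 8 * y\<^sup>2"
proof -
  define G where "G y = y - 3 / 8 * y\<^sup>2 - ln (1 + y)" for y :: real
  have der: "(G has_real_derivative (t * (1 - 3 * t) / (4 * (1 + t)))) (at t)" if "\<bar>t\<bar> \<le> 1 / 3" for t
    unfolding G_def
    by (rule derivative_eq_intros refl | use that in \<open>simp add: field_simps power2_eq_square\<close>)+
  have "G 0 \<le> G y"
  proof (cases "y \<ge> 0")
    case True
    show ?thesis
    proof (rule DERIV_nonneg_imp_nondecreasing[OF True])
      fix t assume "0 \<le> t" "t \<le> y"
      then show "\<exists>d. (G has_real_derivative d) (at t) \<and> 0 \<le> d"
        using der[of t] assms by (intro exI[of _ "t * (1 - 3 * t) / (4 * (1 + t))"]) auto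
    qed
  next
    case False
    show ?thesis
    proof (rule DERIV_nonpos_imp_nonincreasing[of y 0 G])
      fix t assume "y \<le> t" "t \<le> 0"
      then show "\<exists>d. (G has_real_derivative d) (at t) \<and> d \<le> 0"
        using der[of t] assms
        by (intro exI[of _ "t * (1 - 3 * t) / (4 * (1 + t))"]) (auto intro!: divide_nonpos_pos mult_nonpos_nonneg)
    qed (use False in auto)
  qed
  then show ?thesis by (simp add: G_def)
qed

text \<open>Near a point at distance \<open>s\<close> from the origin in direction \<open>e\<close>, the norm grows linearly along \<open>e\<close> and at most
quadratically across \<open>e\<close>.\<close>
lemma norm_le_directional:
  fixes a h e :: "'a::real_inner"
  assumes s: "s > 0" and a: "a = s *\<^sub>R e" and e: "norm e = 1" and h: "\<bar>e \<bullet> h\<bar> \<le> s / 2"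
  shows "norm (a + h) \<le> s + (e \<bullet> h + ((norm h)\<^sup>2 - (e \<bullet> h)\<^sup>2) / s)"
proof -
  define \<sigma> P where "\<sigma> = e \<bullet> h" and "P = (norm h)\<^sup>2 - \<sigma>\<^sup>2"
  have "\<sigma>\<^sup>2 \<le> (norm h)\<^sup>2"
    using Cauchy_Schwarz_ineq2[of e h] e by (simp add: abs_le_square_iff[symmetric] \<sigma>_def)
  then have P: "P \<ge> 0" by (simp add: P_def)
  have s\<sigma>: "s + \<sigma> \<ge> s / 2" using h by (simp add: \<sigma>_def abs_le_iff)
  have "(norm (a + h))\<^sup>2 = (s + \<sigma>)\<^sup>2 + P"
  proof -
    have ee: "e \<bullet> e = 1" using e by (simp add: norm_eq_1)
    show ?thesis
      unfolding P_def a dot_square_norm[symmetric] \<sigma>_def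
      by (simp add: inner_add_left inner_add_right inner_commute[of h e] ee power2_eq_square algebra_simps)
  qed
  also have "\<dots> \<le> (s + \<sigma>)\<^sup>2 + 2 * (s + \<sigma>) / s * P"
  proof -
    have "1 \<le> 2 * (s + \<sigma>) / s" using s s\<sigma> by (simp add: field_simps)
    from mult_right_mono[OF this P] show ?thesis by simp
  qed
  also have "\<dots> \<le> (s + \<sigma> + P / s)\<^sup>2"
  proof -
    have "(s + \<sigma> + P / s)\<^sup>2 = (s + \<sigma>)\<^sup>2 + 2 * (s + \<sigma>) / s * P + (P / s)\<^sup>2"
      unfolding power2_sum[of "s + \<sigma>" "P / s"] by simp
    then show ?thesis using zero_le_power2[of "P / s"] by linarith
  qed
  finally have "norm (a + h) \<le> s + \<sigma> + P / s"
    by (rule power2_le_imp_le) (use s s\<sigma> P in \<open>auto intro!: add_nonneg_nonneg\<close>)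
  then show ?thesis by (simp add: \<sigma>_def P_def)
qed

text \<open>Turns the cone \<open>- ln (1 + k |x|) / 2\<close> into a test function for \<open>supersolution_directional_test\<close>: with
\<open>m = k / (1 + k s)\<close> it has slope \<open>- m / 2\<close> and is bounded below by a quadratic with radial second
derivative \<open>3 / 8 * m\<^sup>2\<close>. This exceeds the square \<open>m\<^sup>2 / 4\<close> of the slope.\<close>
lemma log_cone_directional_bound:
  fixes a h e :: "'a::real_inner"
  assumes k: "k > 0" and s: "s > 0" and a: "a = s *\<^sub>R e" and e: "norm e = 1"
    and m: "m = k / (1 + k * s)" and h: "norm h < s / 2" "norm h < 2 / (9 * m)"
  shows "ln (1 + k * norm (a + h)) / 2 \<le> ln (1 + k * s) / 2 + m / 2 * (e \<bullet> h)
    - 3 / 16 * m\<^sup>2 * (e \<bullet> h)\<^sup>2 + (m / (2 * s) + 3 / 16 * m\<^sup>2) * ((norm h)\<^sup>2 - (e \<bullet> h)\<^sup>2)"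
proof -
  define \<sigma> P where "\<sigma> = e \<bullet> h" and "P = (norm h)\<^sup>2 - \<sigma>\<^sup>2"
  define \<tau> where "\<tau> = \<sigma> + P / s"
  have m0: "m > 0" using k s by (simp add: m add_pos_pos)
  have \<sigma>h: "\<bar>\<sigma>\<bar> \<le> norm h" using Cauchy_Schwarz_ineq2[of e h] e by (simp add: \<sigma>_def)
  then have \<sigma>2: "\<sigma>\<^sup>2 \<le> (norm h)\<^sup>2" by (simp add: abs_le_square_iff[symmetric])
  have P: "0 \<le> P" "P \<le> (norm h)\<^sup>2" using \<sigma>2 by (auto simp: P_def)
  have Ps: "P / s \<le> norm h / 2"
  proof -
    have "P \<le> norm h * (s / 2)"
      using P(2) h(1) mult_left_mono[of "norm h" "s / 2" "norm h"] by (simp add: power2_eq_square)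
    then show ?thesis using s by (simp add: field_simps)
  qed
  have Ps0: "P / s \<ge> 0" using P s by simp
  have "\<bar>\<tau>\<bar> \<le> \<bar>\<sigma>\<bar> + \<bar>P / s\<bar>" unfolding \<tau>_def by (rule abs_triangle_ineq)
  then have \<tau>: "\<bar>\<tau>\<bar> \<le> 3 / 2 * norm h" using \<sigma>h Ps Ps0 by linarith
  have "\<bar>m * \<tau>\<bar> \<le> 1 / 3"
  proof -
    have "\<bar>m * \<tau>\<bar> = m * \<bar>\<tau>\<bar>" using m0 by (simp add: abs_mult)
    also have "\<dots> \<le> m * (3 / 2 * norm h)" using m0 \<tau> by (intro mult_left_mono) auto
    also have "\<dots> \<le> m * (3 / 2 * (2 / (9 * m)))" using m0 h(2) by (intro mult_left_mono) auto
    also have "\<dots> = 1 / 3" using m0 by simp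
    finally show ?thesis .
  qed
  then have ln: "ln (1 + m * \<tau>) \<le> m * \<tau> - 3 / 8 * (m * \<tau>)\<^sup>2" and pos: "1 + m * \<tau> > 0"
    by (rule ln_one_plus_le_quadratic) (use \<open>\<bar>m * \<tau>\<bar> \<le> 1 / 3\<close> in linarith)
  have ks: "1 + k * s > 0" using k s by (simp add: add_pos_pos)
  have "1 + k * norm (a + h) \<le> 1 + k * (s + \<tau>)"
    using norm_le_directional[OF s a e] h(1) \<sigma>h k
    by (simp add: \<tau>_def P_def \<sigma>_def)
  also have "\<dots> = (1 + k * s) * (1 + m * \<tau>)" using ks by (simp add: m field_simps)
  finally have "ln (1 + k * norm (a + h)) \<le> ln ((1 + k * s) * (1 + m * \<tau>))"
    using k by (intro ln_mono) (auto simp: add_pos_nonneg)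
  also have "\<dots> = ln (1 + k * s) + ln (1 + m * \<tau>)" using ks pos by (simp add: ln_mult)
  finally have "ln (1 + k * norm (a + h)) \<le> ln (1 + k * s) + m * \<tau> - 3 / 8 * (m\<^sup>2 * \<tau>\<^sup>2)"
    using ln by (simp add: power_mult_distrib)
  moreover have "m\<^sup>2 * \<tau>\<^sup>2 \<ge> m\<^sup>2 * (\<sigma>\<^sup>2 - P)"
  proof (rule mult_left_mono)
    have "- P \<le> 2 * \<sigma> / s * P"
    proof -
      have "- 1 \<le> 2 * \<sigma> / s" using \<sigma>h h(1) s by (simp add: field_simps abs_le_iff)
      from mult_right_mono[OF this P(1)] show ?thesis by simp
    qed
    moreover have "\<tau>\<^sup>2 = \<sigma>\<^sup>2 + 2 * \<sigma> / s * P + (P / s)\<^sup>2"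
      unfolding \<tau>_def power2_sum[of \<sigma> "P / s"] by simp
    ultimately show "\<sigma>\<^sup>2 - P \<le> \<tau>\<^sup>2"
      using zero_le_power2[of "P / s"] by linarith
  qed simp
  ultimately have "ln (1 + k * norm (a + h)) \<le> ln (1 + k * s) + m * \<tau> - 3 / 8 * (m\<^sup>2 * (\<sigma>\<^sup>2 - P))"
    by linarith
  then have "ln (1 + k * norm (a + h)) / 2 \<le> ln (1 + k * s) / 2 + m / 2 * \<sigma>
      - 3 / 16 * m\<^sup>2 * \<sigma>\<^sup>2 + (m / (2 * s) + 3 / 16 * m\<^sup>2) * P"
    by (simp add: \<tau>_def algebra_simps)
  then show ?thesis unfolding P_def \<sigma>_def .
qed

lemma exp_chord:
  fixes b \<theta> :: real
  assumes "0 \<le> \<theta>" "\<theta> \<le> 1"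
  shows "exp (\<theta> * b) \<le> 1 + \<theta> * (exp b - 1)"
proof -
  have "convex_on UNIV (exp :: real \<Rightarrow> real)" by (rule exp_convex)
  from convex_onD[OF this assms(1,2), of 0 b] show ?thesis by (simp add: algebra_simps)
qed

text \<open>Radius and slope of the logarithmic cone in \<open>supersolution_lipschitz_bound\<close>. The radius \<open>r\<close> is so small
that the excess \<open>m\<^sup>2 / 8\<close> of second derivative over squared slope is larger than \<open>C\<close>. The slope is \<open>k / 2\<close>
with \<open>1 + k r = exp (2 T)\<close>, where \<open>T\<close>, the drop of the cone over the radius, exceeds both \<open>2 M\<close> and \<open>K r\<close>.\<close>
definition lipschitz_radius :: "real \<Rightarrow> real" where
  "lipschitz_radius C = 1 / (8 * (C + 1))"

definition lipschitz_slope :: "real \<Rightarrow> real \<Rightarrow> real \<Rightarrow> real" where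
  "lipschitz_slope M K C =
    (exp (2 * (2 * M + K * lipschitz_radius C + 1)) - 1) / (2 * lipschitz_radius C)"

lemma lipschitz_radius_pos: "C \<ge> 0 \<Longrightarrow> lipschitz_radius C > 0"
  by (simp add: lipschitz_radius_def)

lemma lipschitz_slope_pos:
  assumes "M \<ge> 0" "K \<ge> 0" "C \<ge> 0"
  shows "lipschitz_slope M K C > 0"
proof -
  have "K * lipschitz_radius C \<ge> 0" using assms lipschitz_radius_pos[of C] by simp
  then have "2 * (2 * M + K * lipschitz_radius C + 1) > 0"
    using assms by (intro mult_pos_pos add_nonneg_pos add_nonneg_nonneg) auto
  then show ?thesis
    using lipschitz_radius_pos[OF assms(3)] unfolding lipschitz_slope_def by simp
qed

text \<open>Slide the cone \<open>u x0 - ln (1 + k |x - x0|) / 2\<close> under \<open>u\<close>. It stays below \<open>u\<close> at distance \<open>r\<close> because it has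
dropped by more than the oscillation of \<open>u\<close>, and on the boundary of \<open>\<Omega>\<close> because \<open>u x0\<close> is small near
the boundary. In the interior contact is impossible, since the convexity of the cone violates the
supersolution inequality; here \<open>p \<le> 2\<close> enters through \<open>t\<^sup>p \<le> 1 + t\<^sup>2\<close>.\<close>
lemma supersolution_lipschitz_bound:
  fixes \<Omega> :: "(real^'n) set"
  assumes \<Omega>: "open \<Omega>" "bounded \<Omega>" and p: "0 \<le> p" "p \<le> 2"
    and super: "visc_supersolution \<Omega> p \<gamma> f u" and u: "continuous_on (closure \<Omega>) u"
    and bd: "\<And>x. x \<in> frontier \<Omega> \<Longrightarrow> u x = 0"
    and M: "M \<ge> 0" and uM: "\<And>x. x \<in> closure \<Omega> \<Longrightarrow> \<bar>u x\<bar> \<le> M"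
    and K: "K \<ge> 0" and uK: "\<And>x z. x \<in> closure \<Omega> \<Longrightarrow> z \<in> frontier \<Omega> \<Longrightarrow> u x \<le> K * dist x z"
    and C: "C \<ge> 0" and fC: "\<And>x. x \<in> \<Omega> \<Longrightarrow> 1 + \<gamma> * u x - f x \<le> C"
    and x0: "x0 \<in> closure \<Omega>" and x: "x \<in> closure \<Omega>" and xr: "dist x x0 \<le> lipschitz_radius C"
  shows "u x0 - lipschitz_slope M K C * dist x x0 \<le> u x"
proof -
  define r where "r = lipschitz_radius C"
  have r: "r > 0" unfolding r_def by (rule lipschitz_radius_pos[OF C])
  define T where "T = 2 * M + K * r + 1"
  have Kr: "K * r \<ge> 0" using K r by simp
  have KT: "K * r \<le> T" and T1: "T \<ge> 1" and MT: "T > 2 * M" using M Kr unfolding T_def by linarith+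
  define k where "k = (exp (2 * T) - 1) / r"
  have kr: "1 + k * r = exp (2 * T)" using r by (simp add: k_def)
  have kr1: "k * r \<ge> 1" using kr exp_ge_add_one_self[of "2 * T"] T1 by linarith
  have k: "k > 0" using kr1 r by (metis mult_le_0_iff not_le less_le_trans zero_less_one order_less_imp_le)
  have slope: "lipschitz_slope M K C = k / 2"
    by (simp add: lipschitz_slope_def k_def T_def r_def)
  define S where "S = closure \<Omega> \<inter> cball x0 r"
  define G where "G x = u x + ln (1 + k * norm (x - x0)) / 2" for x
  have S: "compact S" using \<Omega> by (simp add: S_def compact_Int)
  have xS: "x \<in> S" using x xr by (simp add: S_def r_def dist_commute)
  have pos: "1 + k * norm (x - x0) > 0" for x using k by (simp add: add_pos_nonneg)
  have "continuous_on S G"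
    unfolding G_def
  proof (intro continuous_intros)
    show "continuous_on S u" by (rule continuous_on_subset[OF u]) (simp add: S_def)
    show "\<forall>x\<in>S. 1 + k * norm (x - x0) \<noteq> 0" using pos by (metis less_irrefl)
  qed auto
  then obtain a where a: "a \<in> S" and min: "\<And>y. y \<in> S \<Longrightarrow> G a \<le> G y"
    using continuous_attains_inf[OF S, of G] xS by blast
  have "u x0 \<le> G a"
  proof (rule ccontr)
    assume "\<not> u x0 \<le> G a"
    then have lt: "G a < u x0" by simp
    define s where "s = norm (a - x0)"
    have "s \<noteq> 0" using lt by (auto simp: s_def G_def)
    then have s: "s > 0" by (simp add: s_def)
    have ua: "\<bar>u a\<bar> \<le> M" "\<bar>u x0\<bar> \<le> M" using uM a x0 by (auto simp: S_def)
    have "s \<noteq> r"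
    proof
      assume "s = r"
      then have "G a = u a + T" by (simp add: G_def s_def[symmetric] kr)
      then show False using ua MT lt by linarith
    qed
    moreover have "s \<le> r" using a by (simp add: S_def s_def dist_norm norm_minus_commute)
    ultimately have sr: "s < r" by simp
    have "a \<notin> frontier \<Omega>"
    proof
      assume az: "a \<in> frontier \<Omega>"
      \<comment> \<open>The cone is convex in the distance, hence lies below its chord, which drops at
        rate \<open>T / r \<ge> K\<close>.\<close>
      have "exp (s / r * (2 * T)) \<le> 1 + s / r * (exp (2 * T) - 1)"
        using s sr r by (intro exp_chord) auto
      also have "\<dots> = 1 + k * s" using r by (simp add: k_def)
      finally have exp: "exp (s / r * (2 * T)) \<le> 1 + k * s" .
      define X where "X = s / r * T"
      have "2 * X \<le> ln (1 + k * s)"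
        using exp pos[of a] by (simp add: ln_ge_iff s_def X_def mult.left_commute)
      moreover have "K * s \<le> X"
        using mult_left_mono[OF KT, of "s / r"] s r by (simp add: X_def field_simps)
      moreover have "u x0 \<le> K * s"           using uK[OF x0 az] by (simp add: s_def dist_norm norm_minus_commute[of x0 a])
      moreover have "G a = ln (1 + k * s) / 2" using bd az by (simp add: G_def s_def)
      ultimately show False using lt by linarith
    qed
    then have a\<Omega>: "a \<in> \<Omega>" using a \<Omega>(1) by (auto simp: S_def frontier_def interior_open)
    define e where "e = (a - x0) /\<^sub>R s"
    have e: "norm e = 1" using s by (simp add: e_def s_def)
    have ax: "a - x0 = s *\<^sub>R e" using s by (simp add: e_def)
    \<comment> \<open>Slope of the cone at distance \<open>s\<close>, up to the factor \<open>1 / 2\<close>. From \<open>s < r\<close> and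
      \<open>k r \<ge> 1\<close> it is at least \<open>1 / (2 r)\<close>, however large \<open>k\<close> is.\<close>
    define m where "m = k / (1 + k * s)"
    have ks: "1 + k * s > 0" using pos[of a] by (simp add: s_def)
    have m: "m > 0" using k ks by (simp add: m_def)
    define d where "d = min (r - s) (min (s / 2) (2 / (9 * m)))"
    have d: "d > 0" using sr s m by (simp add: d_def)
    have "3 / 8 * m\<^sup>2 \<le> norm ((- (m / 2)) *\<^sub>R e) powr p + \<gamma> * u a - f a"
    proof (rule supersolution_directional_test[OF super a\<Omega> e d])
      fix h assume h: "norm h < d" "a + h \<in> \<Omega>"
      have "norm (a + h - x0) \<le> s + norm h"
        using norm_triangle_ineq[of "a - x0" h] by (simp add: s_def algebra_simps)
      then have "a + h \<in> S"
        using h closure_subset[of \<Omega>] by (auto simp: S_def d_def dist_norm norm_minus_commute)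
      from min[OF this] have "u a + ln (1 + k * s) / 2 \<le> u (a + h) + ln (1 + k * norm (a - x0 + h)) / 2"
        by (simp add: G_def s_def algebra_simps)
      moreover have "ln (1 + k * norm (a - x0 + h)) / 2 \<le> ln (1 + k * s) / 2 + m / 2 * (e \<bullet> h)
          - 3 / 16 * m\<^sup>2 * (e \<bullet> h)\<^sup>2 + (m / (2 * s) + 3 / 16 * m\<^sup>2) * ((norm h)\<^sup>2 - (e \<bullet> h)\<^sup>2)"
        using h by (intro log_cone_directional_bound[OF k s ax e m_def]) (auto simp: d_def)
      ultimately show "u a + ((- (m / 2)) *\<^sub>R e) \<bullet> h + 3 / 8 * m\<^sup>2 / 2 * (e \<bullet> h)\<^sup>2
          - (m / (2 * s) + 3 / 16 * m\<^sup>2) * ((norm h)\<^sup>2 - (e \<bullet> h)\<^sup>2) \<le> u (a + h)"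
        by simp
    qed
    moreover have "norm ((- (m / 2)) *\<^sub>R e) = m / 2" using e m by simp
    moreover have "(m / 2) powr p \<le> 1 + (m / 2)\<^sup>2"
    proof (cases "m / 2 \<le> 1")
      case True
      then have "(m / 2) powr p \<le> 1" using m p by (intro powr_le1) auto
      moreover have "(m / 2)\<^sup>2 \<ge> 0" by simp
      ultimately show ?thesis by linarith
    next
      case False
      then have "(m / 2) powr p \<le> (m / 2) powr 2" using p by (intro powr_mono) auto
      then show ?thesis using m by simp
    qed
    ultimately have "3 / 8 * m\<^sup>2 \<le> (m / 2)\<^sup>2 + C" using fC[OF a\<Omega>] by simp
    then have mC: "m\<^sup>2 \<le> 8 * C" by (simp add: power2_eq_square)
    have "1 + k * s \<le> 2 * (k * r)" using kr1 sr k mult_left_mono[of s r k] by linarith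
    then have "m \<ge> k / (2 * (k * r))" unfolding m_def using k r ks by (intro divide_left_mono) auto
    then have "m \<ge> 4 * (C + 1)" using k C by (simp add: r_def lipschitz_radius_def)
    then have "m\<^sup>2 \<ge> (4 * (C + 1))\<^sup>2" using C by (intro power_mono) auto
    then have "16 * (C + 1)\<^sup>2 \<le> 8 * C" using mC unfolding power_mult_distrib by simp
    moreover have "(C + 1)\<^sup>2 \<ge> C + 1" using C by (simp add: power2_eq_square algebra_simps)
    ultimately show False using C by linarith
  qed
  also have "G a \<le> G x" by (rule min[OF xS])
  also have "G x \<le> u x + k / 2 * dist x x0"
    using ln_add_one_self_le_self[of "k * norm (x - x0)"] k by (simp add: G_def dist_norm)
  finally show ?thesis by (simp add: slope)
qed

text \<open>For a fixed \<open>\<gamma>\<close> the bounds required in \<open>supersolution_lipschitz_bound\<close> come from compactness; this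
qualitative statement is what the comparison principle needs, before a lower bound uniform in \<open>\<gamma>\<close> is
known.\<close>
lemma supersolution_locally_lipschitz:
  fixes \<Omega> :: "(real^'n) set"
  assumes \<Omega>: "open \<Omega>" "bounded \<Omega>" and p: "0 \<le> p" "p \<le> 2"
    and super: "visc_supersolution \<Omega> p \<gamma> f u" and u: "continuous_on (closure \<Omega>) u"
    and bd: "\<And>x. x \<in> frontier \<Omega> \<Longrightarrow> u x = 0" and f: "bounded (f ` \<Omega>)"
    and K: "K \<ge> 0" "\<And>x z. x \<in> closure \<Omega> \<Longrightarrow> z \<in> frontier \<Omega> \<Longrightarrow> u x \<le> K * dist x z"
    and x: "x \<in> \<Omega>"
  shows "\<exists>R L. R > 0 \<and> ball x R \<subseteq> \<Omega> \<and> L-lipschitz_on (ball x R) u"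
proof -
  have "bounded (u ` closure \<Omega>)"
    using \<Omega> by (intro compact_imp_bounded compact_continuous_image u) auto
  then obtain M where M: "M > 0" "\<And>x. x \<in> closure \<Omega> \<Longrightarrow> \<bar>u x\<bar> \<le> M"
    unfolding bounded_pos by auto
  obtain F where F: "F > 0" "\<And>x. x \<in> \<Omega> \<Longrightarrow> \<bar>f x\<bar> \<le> F" using f unfolding bounded_pos by auto
  define C where "C = 1 + \<bar>\<gamma>\<bar> * M + F"
  have C: "C \<ge> 0" using M F by (simp add: C_def)
  have fC: "1 + \<gamma> * u x - f x \<le> C" if "x \<in> \<Omega>" for x
  proof -
    have "\<gamma> * u x \<le> \<bar>\<gamma>\<bar> * M"
      using mult_mono[of "\<bar>\<gamma>\<bar>" "\<bar>\<gamma>\<bar>" "\<bar>u x\<bar>" M] M(2)[of x] that closure_subset[of \<Omega>]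
        abs_ge_self[of "\<gamma> * u x"] by (auto simp: abs_mult)
    then show ?thesis using F(2)[OF that] by (simp add: C_def abs_le_iff)
  qed
  have lip: "u x0 - lipschitz_slope M K C * dist x x0 \<le> u x"
    if "x0 \<in> closure \<Omega>" "x \<in> closure \<Omega>" "dist x x0 \<le> lipschitz_radius C" for x0 x
    using that M(1)
    by (intro supersolution_lipschitz_bound[OF \<Omega> p super u bd _ M(2) K C fC]) auto
  define r where "r = lipschitz_radius C"
  define L where "L = lipschitz_slope M K C"
  have r: "r > 0" and L: "L > 0"
    using lipschitz_radius_pos[OF C] lipschitz_slope_pos[OF _ K(1) C, of M] M(1) by (auto simp: r_def L_def)
  obtain R' where R': "R' > 0" "ball x R' \<subseteq> \<Omega>" using \<Omega>(1) x by (meson openE)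
  define R where "R = min R' (r / 2)"
  have sub: "ball x R \<subseteq> \<Omega>" using R'(2) by (auto simp: R_def)
  have "L-lipschitz_on (ball x R) u"
  proof (rule lipschitz_onI)
    fix y z assume yz: "y \<in> ball x R" "z \<in> ball x R"
    then have cl: "y \<in> closure \<Omega>" "z \<in> closure \<Omega>" using sub closure_subset by blast+
    have d: "dist y z \<le> r"
      using yz dist_triangle[of y z x] by (simp add: R_def dist_commute)
    show "dist (u y) (u z) \<le> L * dist y z"
      using lip[OF cl(1) cl(2)] lip[OF cl(2) cl(1)] d
      by (simp add: dist_real_def abs_le_iff dist_commute r_def L_def)
  qed (use L in simp)
  then show ?thesis using sub R'(1) r by (intro exI[of _ R] exI[of _ L]) (simp add: R_def)
qed

section \<open>Stability under uniform convergence\<close>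

lemma local_min_iff_local_max_uminus:
  "local_min_at S h x \<longleftrightarrow> local_max_at S (\<lambda>y. - h y) x"
  by (simp add: local_min_at_def local_max_at_def)

text \<open>Adding \<open>c / 2 * |y - x0|\<^sup>2\<close> makes the maximum of \<open>v - \<phi>\<close> strict, and a strict maximum persists nearby under
uniform approximation.\<close>
lemma local_max_perturbation:
  fixes u :: "nat \<Rightarrow> real^'n \<Rightarrow> real"
  assumes \<Omega>: "open \<Omega>" and lim: "uniform_limit \<Omega> u v sequentially"
    and u: "\<And>n. continuous_on \<Omega> (u n)" and \<phi>: "continuous_on \<Omega> \<phi>"
    and max: "local_max_at \<Omega> (\<lambda>y. v y - \<phi> y) x0" and c: "c > 0"
  obtains k X where "\<And>m. k m \<ge> m" "\<And>m. X m \<in> \<Omega>" "X \<longlonglongrightarrow> x0" "(\<lambda>m. u (k m) (X m)) \<longlonglongrightarrow> v x0"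
    "\<And>m. local_max_at \<Omega> (\<lambda>y. u (k m) y - (\<phi> y + c / 2 * (norm (y - x0))\<^sup>2)) (X m)"
proof -
  obtain e where x0: "x0 \<in> \<Omega>" and e: "e > 0" "\<And>y. y \<in> \<Omega> \<inter> ball x0 e \<Longrightarrow> v y - \<phi> y \<le> v x0 - \<phi> x0"
    using max unfolding local_max_at_def by blast
  have "continuous_on \<Omega> v" by (rule uniform_limit_theorem[OF _ lim]) (auto simp: u)
  then have vc: "isCont v x0" using \<Omega> x0 by (simp add: continuous_on_eq_continuous_at)
  obtain R where R: "R > 0" "ball x0 R \<subseteq> \<Omega>" using \<Omega> x0 by (meson openE)
  have step: "\<exists>n x. n \<ge> N \<and> x \<in> \<Omega> \<and> dist x x0 < s \<and> \<bar>u n x - v x0\<bar> < s \<and>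
      local_max_at \<Omega> (\<lambda>y. u n y - (\<phi> y + c / 2 * (norm (y - x0))\<^sup>2)) x" if s: "s > 0" for N s
  proof -
    obtain d where d: "d > 0" "\<And>x. dist x x0 < d \<Longrightarrow> dist (v x) (v x0) < s / 2"
      using vc s unfolding continuous_at_eps_delta by (meson half_gt_zero)
    define t where "t = min (min e R) (min s d) / 2"
    have t: "t > 0" "t < e" "t < R" "t < s" "t < d" using e R s d by (auto simp: t_def)
    \<comment> \<open>Moving from \<open>x0\<close> to the sphere of radius \<open>t\<close> costs \<open>c * t\<^sup>2 / 2\<close>, more than the
      error \<open>2 * \<eta>\<close> of the approximation.\<close>
    define \<eta> where "\<eta> = min (s / 2) (c * t\<^sup>2 / 8)"
    have \<eta>: "\<eta> > 0" using s c t by (simp add: \<eta>_def)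
    have "\<forall>\<^sub>F n in sequentially. \<forall>x\<in>\<Omega>. dist (u n x) (v x) < \<eta>" using lim \<eta> by (rule uniform_limitD)
    then obtain n where n: "n \<ge> N" "\<And>x. x \<in> \<Omega> \<Longrightarrow> dist (u n x) (v x) < \<eta>"
      unfolding eventually_sequentially by (meson linear order_refl)
    have sub: "cball x0 t \<subseteq> \<Omega>" using R t by force
    define G where "G y = u n y - (\<phi> y + c / 2 * (norm (y - x0))\<^sup>2)" for y
    have "continuous_on (cball x0 t) G" unfolding G_def
      by (intro continuous_intros continuous_on_subset[OF u sub] continuous_on_subset[OF \<phi> sub])
    moreover have "cball x0 t \<noteq> {}" using t by simp
    ultimately obtain x where x: "x \<in> cball x0 t" and Gmax: "\<And>y. y \<in> cball x0 t \<Longrightarrow> G y \<le> G x"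
      using continuous_attains_sup[OF compact_cball] by blast
    have x\<Omega>: "x \<in> \<Omega>" using x sub by blast
    have "dist x x0 \<noteq> t"
    proof
      assume xt: "dist x x0 = t"
      have "G x0 \<le> G x" using Gmax t by simp
      then have "u n x0 - \<phi> x0 \<le> u n x - \<phi> x - c / 2 * t\<^sup>2"
        by (simp add: G_def xt[unfolded dist_norm])
      moreover have "v x - \<phi> x \<le> v x0 - \<phi> x0" using e(2)[of x] x\<Omega> xt t by (simp add: dist_commute)
      moreover have "\<bar>u n x - v x\<bar> < c * t\<^sup>2 / 8" "\<bar>u n x0 - v x0\<bar> < c * t\<^sup>2 / 8"
        using n(2)[OF x\<Omega>] n(2)[OF x0] unfolding \<eta>_def dist_real_def by linarith+
      ultimately have "c * t\<^sup>2 \<le> c * t\<^sup>2 / 2" by linarith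
      moreover have "c * t\<^sup>2 > 0" using c t by simp
      ultimately show False by linarith
    qed
    then have xt: "dist x x0 < t" using x by (simp add: dist_commute)
    have "local_max_at \<Omega> G x"
      unfolding local_max_at_def
    proof (intro conjI x\<Omega> exI[of _ "t - dist x x0"] ballI)
      show "t - dist x x0 > 0" using xt by simp
      fix y assume "y \<in> \<Omega> \<inter> ball x (t - dist x x0)"
      then have "y \<in> cball x0 t" using dist_triangle[of x0 y x] by (simp add: dist_commute)
      then show "G y \<le> G x" by (rule Gmax)
    qed
    moreover have "\<bar>u n x - v x0\<bar> < s"
      using n(2)[OF x\<Omega>] d(2)[of x] xt t unfolding \<eta>_def dist_real_def by linarith
    ultimately show ?thesis using n(1) x\<Omega> xt t(4) unfolding G_def by (intro exI[of _ n] exI[of _ x]) auto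
  qed
  define s where "s m = inverse (real (Suc m))" for m
  have s: "s m > 0" for m by (simp add: s_def)
  have s0: "s \<longlonglongrightarrow> 0" unfolding s_def by (rule LIMSEQ_inverse_real_of_nat)
  define Q where "Q m n x \<longleftrightarrow> n \<ge> m \<and> x \<in> \<Omega> \<and> dist x x0 < s m \<and> \<bar>u n x - v x0\<bar> < s m \<and>
      local_max_at \<Omega> (\<lambda>y. u n y - (\<phi> y + c / 2 * (norm (y - x0))\<^sup>2)) x" for m n x
  have "\<exists>n x. Q m n x" for m unfolding Q_def by (rule step[OF s])
  then obtain k X where "\<And>m. Q m (k m) (X m)" by metis
  note kX = this[unfolded Q_def]
  show ?thesis
  proof (rule that[of k X])
    show "X \<longlonglongrightarrow> x0"
    proof (rule metric_tendsto_imp_tendsto[OF s0 always_eventually], rule allI)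
      show "dist (X n) x0 \<le> dist (s n) 0" for n using kX[of n] s[of n] by simp
    qed
    show "(\<lambda>m. u (k m) (X m)) \<longlonglongrightarrow> v x0"
    proof (rule metric_tendsto_imp_tendsto[OF s0 always_eventually], rule allI)
      show "dist (u (k n) (X n)) (v x0) \<le> dist (s n) 0" for n using kX[of n] s[of n] by (simp add: dist_real_def)
    qed
  qed (use kX in auto)
qed

lemma tendsto_of_ge_index:
  fixes k :: "nat \<Rightarrow> nat"
  assumes "a \<longlonglongrightarrow> l" "\<And>m. k m \<ge> m"
  shows "(\<lambda>m. a (k m)) \<longlonglongrightarrow> l"
proof (rule filterlim_compose[OF assms(1)])
  show "filterlim k at_top sequentially"
    by (rule filterlim_at_top_mono[OF filterlim_ident]) (simp add: assms(2))
qed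

text \<open>The paraboloid added to the test function changes the operator at the limit point only by \<open>c\<close>.\<close>
lemma tendsto_perturbed_operator:
  fixes X :: "nat \<Rightarrow> real^'n"
  assumes C2: "C2_on \<Omega> \<phi> D\<phi> D2\<phi>" and \<Omega>: "open \<Omega>" "x0 \<in> \<Omega>" and p: "p > 0"
    and X: "X \<longlonglongrightarrow> x0" "\<And>m. X m \<in> \<Omega>"
  shows "(\<lambda>m. - lambda_max (D2\<phi> (X m) + c *\<^sub>R mat 1) + norm (D\<phi> (X m) + c *\<^sub>R (X m - x0)) powr p)
    \<longlonglongrightarrow> - (lambda_max (D2\<phi> x0) + c) + norm (D\<phi> x0) powr p"
proof (rule tendsto_add[OF tendsto_minus tendsto_powr'[OF _ tendsto_const]])
  have sym: "transpose (D2\<phi> x) = D2\<phi> x" if "x \<in> \<Omega>" for x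
    by (rule C2_Hessian_symmetric[OF C2 \<Omega>(1) that])
  have "isCont D2\<phi> x0" using C2_onD(3)[OF C2] \<Omega> by (simp add: continuous_on_eq_continuous_at)
  then have "(\<lambda>m. lambda_max (D2\<phi> (X m))) \<longlonglongrightarrow> lambda_max (D2\<phi> x0)"
    using X sym \<Omega> by (intro tendsto_lambda_max) (auto intro: isCont_tendsto_compose)
  then show "(\<lambda>m. lambda_max (D2\<phi> (X m) + c *\<^sub>R mat 1)) \<longlonglongrightarrow> lambda_max (D2\<phi> x0) + c"
    unfolding lambda_max_add_scaled_identity[OF sym[OF X(2)]] by (intro tendsto_intros)
  have "isCont D\<phi> x0" by (rule has_derivative_continuous[OF C2_onD(2)[OF C2 \<Omega>(2)]])
  then have "(\<lambda>m. D\<phi> (X m) + c *\<^sub>R (X m - x0)) \<longlonglongrightarrow> D\<phi> x0 + c *\<^sub>R (x0 - x0)"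
    by (intro tendsto_intros X(1)) (rule isCont_tendsto_compose[OF _ X(1)])
  then show "(\<lambda>m. norm (D\<phi> (X m) + c *\<^sub>R (X m - x0))) \<longlonglongrightarrow> norm (D\<phi> x0)"
    by (intro tendsto_norm) simp
qed (use p in auto)

text \<open>Test \<open>u\<^sub>n\<close> with the perturbed function at the nearby maxima, pass to the limit, and let the perturbation
parameter \<open>c\<close> tend to \<open>0\<close>.\<close>
lemma visc_subsolution_uniform_limit:
  fixes u :: "nat \<Rightarrow> real^'n \<Rightarrow> real"
  assumes \<Omega>: "open \<Omega>" and p: "p > 0" and f: "continuous_on \<Omega> f"
    and lim: "uniform_limit \<Omega> u v sequentially" and u: "\<And>n. continuous_on \<Omega> (u n)"
    and sub: "\<And>n. visc_subsolution \<Omega> p (\<gamma> n) f (u n)" and \<gamma>: "\<gamma> \<longlonglongrightarrow> \<gamma>0"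
  shows "visc_subsolution \<Omega> p \<gamma>0 f v"
  unfolding visc_subsolution_def
proof (intro conjI allI impI)
  have "continuous_on \<Omega> v" by (rule uniform_limit_theorem[OF _ lim]) (auto simp: u)
  then show "usc_on \<Omega> v" unfolding usc_on_def continuous_on_def by (blast intro: order_tendstoD)
next
  fix \<phi> D\<phi> D2\<phi> x0
  assume C2: "C2_on \<Omega> \<phi> D\<phi> D2\<phi>" and max: "local_max_at \<Omega> (\<lambda>y. v y - \<phi> y) x0"
  have x0: "x0 \<in> \<Omega>" using max by (simp add: local_max_at_def)
  have "- (lambda_max (D2\<phi> x0) + c) + norm (D\<phi> x0) powr p + \<gamma>0 * v x0 \<le> f x0" if c: "c > 0" for c
  proof -
    obtain k X where k: "\<And>m. k m \<ge> m" and X: "\<And>m. X m \<in> \<Omega>" "X \<longlonglongrightarrow> x0"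
        and uX: "(\<lambda>m. u (k m) (X m)) \<longlonglongrightarrow> v x0"
        and maxX: "\<And>m. local_max_at \<Omega> (\<lambda>y. u (k m) y - (\<phi> y + c / 2 * (norm (y - x0))\<^sup>2)) (X m)"
      by (rule local_max_perturbation[OF \<Omega> lim u C2_on_imp_continuous_on[OF C2] max c]) (rule that)
    have ineq: "- lambda_max (D2\<phi> (X m) + c *\<^sub>R mat 1) + norm (D\<phi> (X m) + c *\<^sub>R (X m - x0)) powr p
        + \<gamma> (k m) * u (k m) (X m) \<le> f (X m)" for m
      using sub[of "k m"] C2_on_add_paraboloid[OF C2, of c x0] maxX[of m]
      unfolding visc_subsolution_def by blast
    have "isCont f x0" using f \<Omega> x0 by (simp add: continuous_on_eq_continuous_at)
    then have fX: "(\<lambda>m. f (X m)) \<longlonglongrightarrow> f x0" by (rule isCont_tendsto_compose[OF _ X(2)])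
    show ?thesis
      by (rule tendsto_le[OF _ fX tendsto_add[OF tendsto_perturbed_operator[OF C2 \<Omega> x0 p X(2,1)]
            tendsto_mult[OF tendsto_of_ge_index[OF \<gamma> k] uX]]])
        (use ineq in auto)
  qed
  then have "- lambda_max (D2\<phi> x0) + norm (D\<phi> x0) powr p + \<gamma>0 * v x0 \<le> f x0 + c" if "c > 0" for c
    using that by fastforce
  then show "- lambda_max (D2\<phi> x0) + norm (D\<phi> x0) powr p + \<gamma>0 * v x0 \<le> f x0"
    by (rule field_le_epsilon)
qed

lemma visc_supersolution_uniform_limit:
  fixes u :: "nat \<Rightarrow> real^'n \<Rightarrow> real"
  assumes \<Omega>: "open \<Omega>" and p: "p > 0" and f: "continuous_on \<Omega> f"
    and lim: "uniform_limit \<Omega> u v sequentially" and u: "\<And>n. continuous_on \<Omega> (u n)"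
    and super: "\<And>n. visc_supersolution \<Omega> p (\<gamma> n) f (u n)" and \<gamma>: "\<gamma> \<longlonglongrightarrow> \<gamma>0"
  shows "visc_supersolution \<Omega> p \<gamma>0 f v"
  unfolding visc_supersolution_def
proof (intro conjI allI impI)
  have "continuous_on \<Omega> v" by (rule uniform_limit_theorem[OF _ lim]) (auto simp: u)
  then show "lsc_on \<Omega> v" unfolding lsc_on_def continuous_on_def by (blast intro: order_tendstoD)
next
  fix \<phi> D\<phi> D2\<phi> x0
  assume C2: "C2_on \<Omega> \<phi> D\<phi> D2\<phi>" and min: "local_min_at \<Omega> (\<lambda>y. v y - \<phi> y) x0"
  have x0: "x0 \<in> \<Omega>" using min by (simp add: local_min_at_def)
  have "(\<lambda>y. - v y - - \<phi> y) = (\<lambda>y. - (v y - \<phi> y))" by auto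
  then have max: "local_max_at \<Omega> (\<lambda>y. - v y - - \<phi> y) x0"
    using min by (simp only: local_min_iff_local_max_uminus)
  \<comment> \<open>The operator is not odd, so only the location of the touching points is reduced to
    the case of maxima; the inequality is passed to the limit separately.\<close>
  have "f x0 \<le> - (lambda_max (D2\<phi> x0) + - c) + norm (D\<phi> x0) powr p + \<gamma>0 * v x0" if c: "c > 0" for c
  proof -
    obtain k X where k: "\<And>m. k m \<ge> m" and X: "\<And>m. X m \<in> \<Omega>" "X \<longlonglongrightarrow> x0"
        and uX': "(\<lambda>m. - u (k m) (X m)) \<longlonglongrightarrow> - v x0"
        and maxX: "\<And>m. local_max_at \<Omega> (\<lambda>y. - u (k m) y - (- \<phi> y + c / 2 * (norm (y - x0))\<^sup>2)) (X m)"
      by (rule local_max_perturbation[OF \<Omega> uniform_limit_uminus[OF lim] continuous_on_minus[OF u]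
            continuous_on_minus[OF C2_on_imp_continuous_on[OF C2]] max c]) (rule that)
    have uX: "(\<lambda>m. u (k m) (X m)) \<longlonglongrightarrow> v x0" using tendsto_minus[OF uX'] by simp
    have "(\<lambda>y. - u (k m) y - (- \<phi> y + c / 2 * (norm (y - x0))\<^sup>2))
        = (\<lambda>y. - (u (k m) y - (\<phi> y + (- c) / 2 * (norm (y - x0))\<^sup>2)))" for m
      by auto
    then have "local_min_at \<Omega> (\<lambda>y. u (k m) y - (\<phi> y + (- c) / 2 * (norm (y - x0))\<^sup>2)) (X m)" for m
      using maxX[of m] by (simp only: local_min_iff_local_max_uminus)
    then have ineq: "f (X m) \<le> - lambda_max (D2\<phi> (X m) + (- c) *\<^sub>R mat 1)
        + norm (D\<phi> (X m) + (- c) *\<^sub>R (X m - x0)) powr p + \<gamma> (k m) * u (k m) (X m)" for m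
      using super[of "k m"] C2_on_add_paraboloid[OF C2, of "- c" x0]
      unfolding visc_supersolution_def by blast
    have "isCont f x0" using f \<Omega> x0 by (simp add: continuous_on_eq_continuous_at)
    then have fX: "(\<lambda>m. f (X m)) \<longlonglongrightarrow> f x0" by (rule isCont_tendsto_compose[OF _ X(2)])
    show ?thesis
      by (rule tendsto_le[OF _ tendsto_add[OF tendsto_perturbed_operator[OF C2 \<Omega> x0 p X(2,1)]
            tendsto_mult[OF tendsto_of_ge_index[OF \<gamma> k] uX]] fX])
        (use ineq in auto)
  qed
  then have "f x0 \<le> - lambda_max (D2\<phi> x0) + norm (D\<phi> x0) powr p + \<gamma>0 * v x0 + c" if "c > 0" for c
    using that by fastforce
  then show "f x0 \<le> - lambda_max (D2\<phi> x0) + norm (D\<phi> x0) powr p + \<gamma>0 * v x0"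
    by (rule field_le_epsilon)
qed

section \<open>Vanishing discount\<close>

theorem theorem5p2:
  fixes \<Omega> :: "(real^'n) set" and p :: real
    and f w :: "real^'n \<Rightarrow> real" and u :: "real \<Rightarrow> real^'n \<Rightarrow> real"
  assumes "bounded_C2_domain \<Omega>"
    and "1 < p" and "p \<le> 2"
    and "continuous_on \<Omega> f" and "bounded (f ` \<Omega>)"
    and "\<And>\<gamma>. \<gamma> > 0 \<Longrightarrow> dirichlet_solution \<Omega> p \<gamma> f (u \<gamma>)"
    and "usc_on (closure \<Omega>) w" and "bounded (w ` closure \<Omega>)"
    and "dirichlet_subsolution \<Omega> p 0 f w"
  shows "(\<exists>M. \<forall>\<gamma>>0. \<forall>x\<in>closure \<Omega>. \<bar>u \<gamma> x\<bar> \<le> M) \<and>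
    (\<exists>\<gamma>s v. (\<forall>n::nat. \<gamma>s n > 0) \<and> \<gamma>s \<longlonglongrightarrow> 0 \<and>
       uniform_limit (closure \<Omega>) (\<lambda>n. u (\<gamma>s n)) v sequentially \<and>
       dirichlet_solution \<Omega> p 0 f v)"
proof -
  have \<Omega>: "open \<Omega>" "bounded \<Omega>" "\<Omega> \<noteq> {}" using assms(1) by (auto simp: bounded_C2_domain_def)
  have p0: "p > 0" "0 \<le> p" using assms(2) by auto
  have u: "continuous_on (closure \<Omega>) (u \<gamma>)" "\<And>x. x \<in> frontier \<Omega> \<Longrightarrow> u \<gamma> x = 0"
      "visc_subsolution \<Omega> p \<gamma> f (u \<gamma>)" "visc_supersolution \<Omega> p \<gamma> f (u \<gamma>)" if "\<gamma> > 0" for \<gamma>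
    using assms(6)[OF that] by (auto simp: dirichlet_solution_def)
  obtain F where F: "F > 0" "\<And>x. x \<in> \<Omega> \<Longrightarrow> \<bar>f x\<bar> \<le> F" using assms(5) unfolding bounded_pos by auto
  obtain K where K: "K > 0" and "\<And>\<gamma> f u x z. \<gamma> \<ge> 0 \<Longrightarrow> (\<forall>x\<in>\<Omega>. f x \<le> F) \<Longrightarrow> continuous_on (closure \<Omega>) u \<Longrightarrow>
      dirichlet_subsolution \<Omega> p \<gamma> f u \<Longrightarrow> x \<in> closure \<Omega> \<Longrightarrow> z \<in> frontier \<Omega> \<Longrightarrow> u x \<le> K * dist x z"
    by (rule dirichlet_subsolution_le_dist_frontier[OF assms(1,2), of F]) (rule that)
  note barrier = this(2)
  have upper: "u \<gamma> x \<le> K * dist x z" if "\<gamma> > 0" "x \<in> closure \<Omega>" "z \<in> frontier \<Omega>" for \<gamma> x z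
  proof (rule barrier[of \<gamma> f])
    show "\<forall>x\<in>\<Omega>. f x \<le> F" using F(2) by (auto simp: abs_le_iff)
    show "dirichlet_subsolution \<Omega> p \<gamma> f (u \<gamma>)"
      using u(2,3)[OF that(1)] by (simp add: dirichlet_subsolution_def)
  qed (use that u(1) in auto)
  obtain W where W: "W > 0" "\<And>x. x \<in> closure \<Omega> \<Longrightarrow> \<bar>w x\<bar> \<le> W" using assms(8) unfolding bounded_pos by auto
  have lower: "w x - W \<le> u \<gamma> x" if \<gamma>: "\<gamma> > 0" and x: "x \<in> closure \<Omega>" for \<gamma> x
  proof (rule comparison_principle[OF \<Omega>(1,2) p0(1) \<gamma> assms(4) u(4)[OF \<gamma>] u(1)[OF \<gamma>] _ _ _ _ x])
    show "\<exists>R L. R > 0 \<and> ball x R \<subseteq> \<Omega> \<and> L-lipschitz_on (ball x R) (u \<gamma>)" if "x \<in> \<Omega>" for x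
      by (rule supersolution_locally_lipschitz[OF \<Omega>(1,2) p0(2) assms(3) u(4)[OF \<gamma>] u(1)[OF \<gamma>]
            u(2)[OF \<gamma>] assms(5) less_imp_le[OF K] upper[OF \<gamma>] that])
    have "w x \<le> W" if "x \<in> \<Omega>" for x
      using W(2)[of x] closure_subset[of \<Omega>] that by (auto simp: abs_le_iff)
    then show "visc_subsolution \<Omega> p \<gamma> f (\<lambda>x. w x - W)"
      using assms(9) \<gamma> by (intro visc_subsolution_shift) (auto simp: dirichlet_subsolution_def)
    show "usc_on (closure \<Omega>) (\<lambda>x. w x - W)"
      using assms(7) by (rule usc_on_diff_const)
    show "w x - W \<le> u \<gamma> x" if "x \<in> frontier \<Omega>" for x
      using assms(9) W(1) u(2)[OF \<gamma> that] that by (force simp: dirichlet_subsolution_def)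
  qed
  have "frontier \<Omega> \<noteq> {}" using \<Omega> by (metis frontier_eq_empty not_bounded_UNIV)
  then obtain z where z: "z \<in> frontier \<Omega>" by blast
  have "bounded (closure \<Omega>)" using \<Omega>(2) by (rule bounded_closure)
  then obtain D where D: "\<And>x. x \<in> closure \<Omega> \<Longrightarrow> dist z x \<le> D" using bounded_any_center by blast
  define M where "M = max (K * D) (2 * W)"
  have M0: "M \<ge> 0" using W(1) by (simp add: M_def)
  have M: "\<bar>u \<gamma> x\<bar> \<le> M" if \<gamma>: "\<gamma> > 0" and x: "x \<in> closure \<Omega>" for \<gamma> x
  proof -
    have "K * dist x z \<le> K * D" using K D[OF x] by (simp add: dist_commute)
    then have "u \<gamma> x \<le> M" using upper[OF \<gamma> x z] by (simp add: M_def)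
    moreover have "- M \<le> u \<gamma> x" using lower[OF \<gamma> x] W(2)[OF x] unfolding M_def by linarith
    ultimately show ?thesis by simp
  qed
  \<comment> \<open>For \<open>\<gamma> \<le> 1\<close> the zeroth-order term \<open>\<gamma> u\<close> is bounded by \<open>M\<close>, so that one constant
    serves the whole family.\<close>
  define C where "C = 1 + M + F"
  have C: "C \<ge> 0" using M0 F by (simp add: C_def)
  define r where "r = lipschitz_radius C"
  define L where "L = lipschitz_slope M K C"
  have r: "r > 0" and L: "L > 0"
    using lipschitz_radius_pos[OF C] lipschitz_slope_pos[OF M0 _ C, of K] K by (auto simp: r_def L_def)
  have lip: "u \<gamma> x0 - L * dist x x0 \<le> u \<gamma> x"
    if \<gamma>: "0 < \<gamma>" "\<gamma> \<le> 1" and x: "x0 \<in> closure \<Omega>" "x \<in> closure \<Omega>" "dist x x0 \<le> r" for \<gamma> x0 x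
  proof -
    have "1 + \<gamma> * u \<gamma> x - f x \<le> C" if "x \<in> \<Omega>" for x
    proof -
      have "\<bar>\<gamma> * u \<gamma> x\<bar> \<le> 1 * M"
        unfolding abs_mult using M[OF \<gamma>(1), of x] that closure_subset[of \<Omega>] \<gamma> M0
        by (intro mult_mono) auto
      then show ?thesis using F(2)[OF that] by (simp add: C_def abs_le_iff)
    qed
    then show ?thesis
      using x unfolding L_def r_def
      by (intro supersolution_lipschitz_bound[OF \<Omega>(1,2) p0(2) assms(3) u(4)[OF \<gamma>(1)] u(1)[OF \<gamma>(1)]
            u(2)[OF \<gamma>(1)] M0 M[OF \<gamma>(1)] less_imp_le[OF K] upper[OF \<gamma>(1)] C]) auto
  qed
  define \<gamma>0 where "\<gamma>0 n = inverse (real (Suc n))" for n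
  have \<gamma>0: "0 < \<gamma>0 n" "\<gamma>0 n \<le> 1" for n by (auto simp: \<gamma>0_def field_simps)
  have \<gamma>0_lim: "\<gamma>0 \<longlonglongrightarrow> 0" unfolding \<gamma>0_def by (rule LIMSEQ_inverse_real_of_nat)
  have compact: "compact (closure \<Omega>)" using \<Omega>(2) by simp
  obtain v k where v: "continuous_on (closure \<Omega>) v" and k: "strict_mono (k :: nat \<Rightarrow> nat)"
    and conv: "\<And>e. 0 < e \<Longrightarrow> \<exists>N. \<forall>n x. n \<ge> N \<and> x \<in> closure \<Omega> \<longrightarrow> norm (u (\<gamma>0 (k n)) x - v x) < e"
  proof (rule Arzela_Ascoli[OF compact, of "\<lambda>n. u (\<gamma>0 n)" M])
    show "norm (u (\<gamma>0 n) x) \<le> M" if "x \<in> closure \<Omega>" for n x using M[OF \<gamma>0(1) that] by simp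
    fix x e assume x: "x \<in> closure \<Omega>" and e: "0 < (e :: real)"
    define d where "d = min r (e / L)"
    have "norm (u (\<gamma>0 n) x - u (\<gamma>0 n) y) < e" if y: "y \<in> closure \<Omega>" "norm (x - y) < d" for n y
    proof -
      have d: "dist x y \<le> r" "dist y x \<le> r" using y(2) by (auto simp: d_def dist_norm norm_minus_commute)
      have "norm (u (\<gamma>0 n) x - u (\<gamma>0 n) y) \<le> L * dist x y"
        using lip[OF \<gamma>0(1)[of n] \<gamma>0(2) x y(1) d(2)] lip[OF \<gamma>0(1)[of n] \<gamma>0(2) y(1) x d(1)]
        by (simp add: abs_le_iff dist_commute)
      also have "\<dots> < e" using y(2) L by (simp add: d_def dist_norm field_simps)
      finally show ?thesis .
    qed
    then show "\<exists>d. 0 < d \<and> (\<forall>n y. y \<in> closure \<Omega> \<and> norm (x - y) < d \<longrightarrow> norm (u (\<gamma>0 n) x - u (\<gamma>0 n) y) < e)"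
      using r L e by (intro exI[of _ d]) (auto simp: d_def)
  qed (rule that)
  define \<gamma>s where "\<gamma>s n = \<gamma>0 (k n)" for n
  have \<gamma>s: "\<gamma>s n > 0" for n using \<gamma>0 by (simp add: \<gamma>s_def)
  have \<gamma>s_lim: "\<gamma>s \<longlonglongrightarrow> 0"
    using LIMSEQ_subseq_LIMSEQ[OF \<gamma>0_lim k] by (simp add: \<gamma>s_def[abs_def] o_def)
  have lim: "uniform_limit (closure \<Omega>) (\<lambda>n. u (\<gamma>s n)) v sequentially"
    unfolding uniform_limit_sequentially_iff
  proof (intro allI impI)
    fix e :: real assume "e > 0"
    from conv[OF this] show "\<exists>N. \<forall>n\<ge>N. \<forall>x\<in>closure \<Omega>. dist (u (\<gamma>s n) x) (v x) < e"
      unfolding \<gamma>s_def dist_norm by blast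
  qed
  have lim\<Omega>: "uniform_limit \<Omega> (\<lambda>n. u (\<gamma>s n)) v sequentially"
    by (rule uniform_limit_on_subset[OF lim closure_subset])
  have u\<Omega>: "continuous_on \<Omega> (u (\<gamma>s n))" for n
    by (rule continuous_on_subset[OF u(1)[OF \<gamma>s] closure_subset])
  have "dirichlet_solution \<Omega> p 0 f v"
    unfolding dirichlet_solution_def
  proof (intro conjI ballI v)
    fix x assume x: "x \<in> frontier \<Omega>"
    then have "x \<in> closure \<Omega>" by (simp add: frontier_def)
    then have "(\<lambda>n. u (\<gamma>s n) x) \<longlonglongrightarrow> v x" by (rule tendsto_uniform_limitI[OF lim])
    then show "v x = 0" using u(2)[OF \<gamma>s x] by (simp add: LIMSEQ_const_iff)
  next
    show "visc_subsolution \<Omega> p 0 f v"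
      by (rule visc_subsolution_uniform_limit[OF \<Omega>(1) p0(1) assms(4) lim\<Omega> u\<Omega> u(3)[OF \<gamma>s] \<gamma>s_lim])
    show "visc_supersolution \<Omega> p 0 f v"
      by (rule visc_supersolution_uniform_limit[OF \<Omega>(1) p0(1) assms(4) lim\<Omega> u\<Omega> u(4)[OF \<gamma>s] \<gamma>s_lim])
  qed
  then show ?thesis using M \<gamma>s \<gamma>s_lim lim by blast
qed

end
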